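(* Let $a$ be a positive integer. Let $\widehat{x}$ denote multiplication by $x$ and let $\widehat{y} = -\hbar \frac{\partial}{\partial x}$. Then the partition function $Z^{[a]}(x,\hbar)$ for the enumeration of $a$-hypermaps satisfies $$\left[ \widehat{y}^{\,a} - \widehat{x}\,\widehat{y} + 1 \right] Z^{[a]}(x, \hbar) = 0,$$ where $Z^{[a]}(x,\hbar) = x^{-1/\hbar}\,\overline{Z}^{[a]}(x,\hbar)$ with $\overline{Z}^{[a]}(x,\hbar) \in \mathbb{Q}[\hbar^{\pm 1}][[x^{-1}]]$, and the equation is understood formally as $$x^{1/\hbar} \left[ \widehat{y}^{\,a} - \widehat{x}\,\widehat{y} + 1 \right] x^{-1/\hbar}\, \overline{Z}^{[a]}(x, \hbar) = 0 .$$
   Context: Fix a positive integer $a$. For integers $g \ge 0$, $n \ge 1$ and positive integers $b_1,\ldots,b_n$, let $M_{g,n}^{[a]}(b_1, \ldots, b_n)$ denote the weighted count of connected genus $g$ branched covers of marked Riemann surfaces $f: (S; p_1, \ldots, p_n) \to (\mathbb{P}^1; \infty)$ such that (i) $f$ is unramified over $\mathbb{P}^1 \setminus \{0,1,\infty\}$; (ii) each point in $f^{-1}(1)$ has ramification order $a$; (iii) the preimage divisor $f^{-1}(\infty)$ equals $b_1p_1 + \cdots + b_np_n$. Two covers $S_1\to\mathbb{P}^1$ and $S_2\to\mathbb{P}^1$ are equivalent if there is an isomorphism $S_1\to S_2$ preserving the marked points and covering the identity on $\mathbb{P}^1$; one counts equivalence classes, each weighted by the reciprocal of its number of automorphisms.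 Equivalently (by monodromy and the Riemann existence theorem), with $d = b_1+\cdots+b_n$, this is the count, weighted by reciprocals of numbers of automorphisms, of equivalence classes of triples $(\sigma_0,\sigma_1,\sigma_2)$ of permutations in $S_d$ with $\sigma_0\sigma_1\sigma_2 = \mathrm{id}$, generating a transitive subgroup, such that $\sigma_1$ has cycle type $(a,a,\ldots,a)$, $\sigma_2$ has exactly $n$ disjoint cycles (fixed points count as cycles) labelled $1,\ldots,n$ with the cycle labelled $i$ of length $b_i$, and $\sigma_0$ has $v = 2-2g-n+(a-1)\frac{d}{a}$ cycles. Equivalence is simultaneous conjugation preserving the labels. Free energies: for $g\ge 0$, $n \ge 1$, $$\overline{F}_{g,n}^{[a]}(x_1, \ldots, x_n) = \sum_{b_1, \ldots, b_n = 1}^\infty M_{g,n}^{[a]}(b_1, \ldots, b_n) \, x_1^{-b_1} \cdots x_n^{-b_n},$$ and $F_{g,n}^{[a]} = \overline{F}_{g,n}^{[a]}$ except that $F_{0,1}^{[a]}(x_1) = -\log x_1 + \overline{F}_{0,1}^{[a]}(x_1)$. The partition function is $$Z^{[a]}(x, \hbar) = \exp \left[ \sum_{g=0}^\infty \sum_{n=1}^\infty \frac{\hbar^{2g-2+n}}{n!} F_{g,n}^{[a]}(x, \ldots, x) \right] = x^{-1/\hbar}\,\overline{Z}^{[a]}(x,\hbar),$$ $$\overline{Z}^{[a]}(x,\hbar) = \exp \left[ \sum_{g=0}^\infty \sum_{n=1}^\infty \frac{\hbar^{2g-2+n}}{n!} \overline{F}_{g,n}^{[a]}(x, \ldots, x)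 \right] \in \mathbb{Q}[\hbar^{\pm1}][[x^{-1}]].$$ Here $x^{-1/\hbar}$ is a formal symbol on which $\frac{\partial}{\partial x}$ acts by the usual rule $\frac{\partial}{\partial x} x^{-1/\hbar} = -\hbar^{-1} x^{-1/\hbar} x^{-1}$; thus conjugating by it, $x^{1/\hbar}\,\widehat{y}\,x^{-1/\hbar} = -\hbar\frac{\partial}{\partial x} + x^{-1}$ as an operator on $\mathbb{Q}[\hbar^{\pm1}][[x^{-1}]]$. *)

theory Defs
  imports
    "HOL-Combinatorics.Orbits"
    "HOL-Algebra.Sym_Groups"
    "HOL-Library.Poly_Mapping"
    "HOL-Computational_Algebra.Formal_Laurent_Series"
begin

unbundle fps_syntax

section \<open>Labelled permutation triples\<close>

definition perm_cycles :: "nat \<Rightarrow> (nat \<Rightarrow> nat) \<Rightarrow> nat set set" where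
  "perm_cycles d \<sigma> = orbit \<sigma> ` {1..d}"

text \<open>The fourth component lists the cycles of \<open>\<sigma>\<^sub>2\<close> in the order of their labels; the list
  index (shifted by one) is the label.\<close>

type_synonym labelled_triple =
  "(nat \<Rightarrow> nat) \<times> (nat \<Rightarrow> nat) \<times> (nat \<Rightarrow> nat) \<times> nat set list"

text \<open>\<open>n\<close> is the length of \<open>bs\<close> and \<open>d\<close> its sum. The Riemann-Hurwitz condition is stated over the
  rationals, so that neither the subtractions nor \<open>d / a\<close> are truncated.\<close>

definition hypermaps :: "nat \<Rightarrow> nat \<Rightarrow> nat list \<Rightarrow> labelled_triple set" where
  "hypermaps a g bs = (let d = sum_list bs; n = length bs in
     {(\<sigma>0, \<sigma>1, \<sigma>2, cs).
        \<sigma>0 permutes {1..d} \<and> \<sigma>1 permutes {1..d} \<and> \<sigma>2 permutes {1..d} \<and>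
        \<sigma>0 \<circ> \<sigma>1 \<circ> \<sigma>2 = id \<and>
        (\<forall>x\<in>{1..d}. \<forall>y\<in>{1..d}. \<exists>\<pi>\<in>generate (sym_group d) {\<sigma>0, \<sigma>1, \<sigma>2}. \<pi> x = y) \<and>
        (\<forall>c\<in>perm_cycles d \<sigma>1. card c = a) \<and>
        distinct cs \<and> set cs = perm_cycles d \<sigma>2 \<and> map card cs = bs \<and>
        (of_nat (card (perm_cycles d \<sigma>0)) :: rat)
          = 2 - 2 * of_nat g - of_nat n + (of_nat a - 1) * (of_nat d / of_nat a)})"

fun conjugate :: "(nat \<Rightarrow> nat) \<Rightarrow> labelled_triple \<Rightarrow> labelled_triple" where
  "conjugate \<pi> (\<sigma>0, \<sigma>1, \<sigma>2, cs) =
     (\<pi> \<circ> \<sigma>0 \<circ> Hilbert_Choice.inv \<pi>, \<pi> \<circ> \<sigma>1 \<circ> Hilbert_Choice.inv \<pi>,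
      \<pi> \<circ> \<sigma>2 \<circ> Hilbert_Choice.inv \<pi>, map ((`) \<pi>) cs)"

definition hypermap_equiv :: "nat \<Rightarrow> nat \<Rightarrow> nat list \<Rightarrow> (labelled_triple \<times> labelled_triple) set" where
  "hypermap_equiv a g bs =
     {(\<tau>, \<tau>'). \<tau> \<in> hypermaps a g bs \<and> \<tau>' \<in> hypermaps a g bs \<and>
               (\<exists>\<pi>. \<pi> permutes {1..sum_list bs} \<and> \<tau>' = conjugate \<pi> \<tau>)}"

definition automorphisms :: "nat \<Rightarrow> labelled_triple \<Rightarrow> (nat \<Rightarrow> nat) set" where
  "automorphisms d \<tau> = {\<pi>. \<pi> permutes {1..d} \<and> conjugate \<pi> \<tau> = \<tau>}"

definition hypermap_count :: "nat \<Rightarrow> nat \<Rightarrow> nat list \<Rightarrow> rat" where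
  "hypermap_count a g bs =
     (\<Sum>C\<in>hypermaps a g bs // hypermap_equiv a g bs.
        1 / of_nat (card (automorphisms (sum_list bs) (SOME \<tau>. \<tau> \<in> C))))"

text \<open>The weight of a class does not depend on the chosen representative.\<close>

lemma conjugate_conjugate:
  assumes "\<pi> permutes A" "\<rho> permutes A"
  shows "conjugate \<pi> (conjugate \<rho> \<tau>) = conjugate (\<pi> \<circ> \<rho>) \<tau>"
  using assms by (cases \<tau>) (auto simp: o_inv_distrib permutes_bij fun_eq_iff image_comp)

lemma conjugate_id: "conjugate id \<tau> = \<tau>"
  by (cases \<tau>) (auto simp: fun_eq_iff map_idI)

lemma card_automorphisms_conjugate:
  assumes p: "\<pi> permutes {1..d}"
  shows "card (automorphisms d (conjugate \<pi> \<tau>)) = card (automorphisms d \<tau>)"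
proof -
  let ?i = "Hilbert_Choice.inv \<pi>"
  have i: "?i permutes {1..d}" using p by (rule permutes_inv)
  have c: "\<pi> \<circ> ?i = id" "?i \<circ> \<pi> = id" using permutes_inv_o[OF p] by auto
  have c': "\<And>x. \<pi> (?i x) = x" "\<And>x. ?i (\<pi> x) = x" using c by (simp_all add: fun_eq_iff)
  have ii: "conjugate ?i (conjugate \<pi> \<tau>) = \<tau>"
    by (simp add: conjugate_conjugate[OF i p] c conjugate_id)
  have "bij_betw (\<lambda>\<rho>. \<pi> \<circ> \<rho> \<circ> ?i) (automorphisms d \<tau>) (automorphisms d (conjugate \<pi> \<tau>))"
  proof (rule bij_betw_byWitness[where f' = "\<lambda>\<rho>. ?i \<circ> \<rho> \<circ> \<pi>"])
    show "\<forall>\<rho>\<in>automorphisms d \<tau>. ?i \<circ> (\<pi> \<circ> \<rho> \<circ> ?i) \<circ> \<pi> = \<rho>"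
      by (simp add: fun_eq_iff c')
    show "\<forall>\<rho>\<in>automorphisms d (conjugate \<pi> \<tau>). \<pi> \<circ> (?i \<circ> \<rho> \<circ> \<pi>) \<circ> ?i = \<rho>"
      by (simp add: fun_eq_iff c')
    show "(\<lambda>\<rho>. \<pi> \<circ> \<rho> \<circ> ?i) ` automorphisms d \<tau> \<subseteq> automorphisms d (conjugate \<pi> \<tau>)"
    proof clarify
      fix \<rho> assume "\<rho> \<in> automorphisms d \<tau>"
      then have r: "\<rho> permutes {1..d}" "conjugate \<rho> \<tau> = \<tau>" by (auto simp: automorphisms_def)
      have "conjugate (\<pi> \<circ> \<rho> \<circ> ?i) (conjugate \<pi> \<tau>) = conjugate \<pi> (conjugate \<rho> (conjugate ?i (conjugate \<pi> \<tau>)))"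
        by (simp only: conjugate_conjugate[OF permutes_compose[OF r(1) p] i]
            conjugate_conjugate[OF p r(1)])
      then show "\<pi> \<circ> \<rho> \<circ> ?i \<in> automorphisms d (conjugate \<pi> \<tau>)"
        using permutes_compose[OF i permutes_compose[OF r(1) p]] by (simp add: automorphisms_def ii r)
    qed
    show "(\<lambda>\<rho>. ?i \<circ> \<rho> \<circ> \<pi>) ` automorphisms d (conjugate \<pi> \<tau>) \<subseteq> automorphisms d \<tau>"
    proof clarify
      fix \<rho> assume "\<rho> \<in> automorphisms d (conjugate \<pi> \<tau>)"
      then have r: "\<rho> permutes {1..d}" "conjugate \<rho> (conjugate \<pi> \<tau>) = conjugate \<pi> \<tau>"
        by (auto simp: automorphisms_def)
      have "conjugate (?i \<circ> \<rho> \<circ> \<pi>) \<tau> = conjugate ?i (conjugate \<rho> (conjugate \<pi> \<tau>))"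
        by (simp only: conjugate_conjugate[OF permutes_compose[OF r(1) i] p]
            conjugate_conjugate[OF i r(1)])
      then show "?i \<circ> \<rho> \<circ> \<pi> \<in> automorphisms d \<tau>"
        using permutes_compose[OF p permutes_compose[OF r(1) i]] by (simp add: automorphisms_def ii r)
    qed
  qed
  then show ?thesis by (simp add: bij_betw_same_card)
qed

section \<open>Free energies and the partition function\<close>

text \<open>Laurent polynomials in \<open>\<hbar>\<close> with rational coefficients, as the group algebra of the integers.
  Power series over them are series in \<open>x\<inverse>\<close>: the series variable \<open>fps_X\<close> stands for \<open>x\<inverse>\<close>.\<close>

type_synonym hbar_laurent = "int \<Rightarrow>\<^sub>0 rat"

definition hbar_monom :: "rat \<Rightarrow> int \<Rightarrow> hbar_laurent" where
  "hbar_monom c k = Poly_Mapping.single k c"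

text \<open>The diagonal \<open>x\<^sub>1 = \<dots> = x\<^sub>n = x\<close> of the free energy without its logarithmic term, which is the
  only specialization that enters the partition function: the coefficient of \<open>x\<close> to the power
  \<open>-d\<close> collects all \<open>(b\<^sub>1, \<dots>, b\<^sub>n)\<close> with sum \<open>d\<close>.\<close>

definition free_energy_diag :: "nat \<Rightarrow> nat \<Rightarrow> nat \<Rightarrow> hbar_laurent fps" where
  "free_energy_diag a g n = Abs_fps (\<lambda>d.
     hbar_monom (\<Sum>bs\<in>{bs. length bs = n \<and> (\<forall>b\<in>set bs. b \<ge> 1) \<and> sum_list bs = d}.
                   hypermap_count a g bs) 0)"

text \<open>\<open>suminf\<close> is written out because the notation of \<open>Sum_any\<close> is the same. The infinite
  sums are limits in the \<open>x\<inverse>\<close>-adic topology; \<open>Suc n\<close> runs over the positive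
  integers.\<close>

definition log_partition_term :: "nat \<Rightarrow> nat \<Rightarrow> nat \<Rightarrow> hbar_laurent fps" where
  "log_partition_term a g n =
     fps_const (hbar_monom (1 / fact n) (2 * int g - 2 + int n)) * free_energy_diag a g n"

definition log_partition :: "nat \<Rightarrow> hbar_laurent fps" where
  "log_partition a = suminf (\<lambda>g. suminf (\<lambda>n. log_partition_term a g (Suc n)))"

text \<open>The library's \<open>fps_exp\<close> needs coefficients in a field.\<close>

definition exp_series :: "hbar_laurent fps" where
  "exp_series = Abs_fps (\<lambda>k. hbar_monom (1 / fact k) 0)"

definition Zbar :: "nat \<Rightarrow> hbar_laurent fps" where
  "Zbar a = exp_series oo log_partition a"

text \<open>Both sums converge, and \<open>log_partition\<close> has no constant term, as the composition requires.\<close>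

lemma hypermap_count_eq_0:
  assumes "sum_list bs < g" "bs \<noteq> []"
  shows "hypermap_count a g bs = 0"
proof -
  have "hypermaps a g bs = {}"
  proof (rule ccontr)
    assume "hypermaps a g bs \<noteq> {}"
    then obtain \<sigma>0 where
      *: "(of_nat (card (perm_cycles (sum_list bs) \<sigma>0)) :: rat) = 2 - 2 * of_nat g
          - of_nat (length bs) + (of_nat a - 1) * (of_nat (sum_list bs) / of_nat a)"
      unfolding hypermaps_def Let_def by auto
    have "(of_nat a - 1) * (of_nat (sum_list bs) / of_nat a) \<le> (of_nat (sum_list bs) :: rat)"
      by (cases "a = 0") (auto simp: field_simps)
    moreover have "(of_nat (length bs) :: rat) \<ge> 1" using assms by (cases bs) auto
    moreover have "(of_nat (sum_list bs) :: rat) + 1 \<le> of_nat g"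
      using assms of_nat_le_iff[of "sum_list bs + 1" g, where 'a = rat] by simp
    moreover have "(of_nat (card (perm_cycles (sum_list bs) \<sigma>0)) :: rat) \<ge> 0"
      "(of_nat (sum_list bs) :: rat) \<ge> 0" by simp_all
    ultimately show False using * by linarith
  qed
  then show ?thesis by (simp add: hypermap_count_def)
qed

lemma length_le_sum_list: "\<forall>b\<in>set bs. b \<ge> 1 \<Longrightarrow> length bs \<le> sum_list (bs :: nat list)"
  by (induction bs) auto

lemma log_partition_term_nth_eq_0:
  assumes "d < g \<or> d \<le> n"
  shows "log_partition_term a g (Suc n) $ d = 0"
proof -
  have "(\<Sum>bs\<in>{bs. length bs = Suc n \<and> (\<forall>b\<in>set bs. b \<ge> 1) \<and> sum_list bs = d}.
          hypermap_count a g bs) = 0"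
    using assms length_le_sum_list by (intro sum.neutral) (fastforce intro: hypermap_count_eq_0)
  then show ?thesis
    by (simp add: log_partition_term_def free_energy_diag_def hbar_monom_def)
qed

lemma fps_sums_triangular:
  fixes f :: "nat \<Rightarrow> 'a :: comm_ring_1 fps"
  assumes "\<And>k d. d < k \<Longrightarrow> f k $ d = 0"
  shows "f sums Abs_fps (\<lambda>d. \<Sum>k\<le>d. f k $ d)"
  unfolding sums_def
proof (rule tendsto_fpsI)
  fix d
  have "sum (\<lambda>k. f k $ d) {..<N} = (\<Sum>k\<le>d. f k $ d)" if "N > d" for N
    using that assms by (intro sum.mono_neutral_right) auto
  then show "\<forall>\<^sub>F N in sequentially. sum f {..<N} $ d = Abs_fps (\<lambda>d. \<Sum>k\<le>d. f k $ d) $ d"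
    by (intro eventually_mono[OF eventually_gt_at_top[of d]]) (simp add: fps_sum_nth)
qed

lemma log_partition_inner_sums:
  "(\<lambda>n. log_partition_term a g (Suc n)) sums
     Abs_fps (\<lambda>d. \<Sum>n\<le>d. log_partition_term a g (Suc n) $ d)"
  by (rule fps_sums_triangular) (simp add: log_partition_term_nth_eq_0)

lemma log_partition_sums:
  "(\<lambda>g. suminf (\<lambda>n. log_partition_term a g (Suc n))) sums
     Abs_fps (\<lambda>d. \<Sum>g\<le>d. \<Sum>n\<le>d. log_partition_term a g (Suc n) $ d)"
  using fps_sums_triangular[of "\<lambda>g. suminf (\<lambda>n. log_partition_term a g (Suc n))"]
  by (simp add: sums_unique[OF log_partition_inner_sums, symmetric] log_partition_term_nth_eq_0)

lemma log_partition_nth: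
  "log_partition a $ d = (\<Sum>g\<le>d. \<Sum>n\<le>d. log_partition_term a g (Suc n) $ d)"
  by (simp add: log_partition_def sums_unique[OF log_partition_sums, symmetric])

lemma log_partition_nth_0: "log_partition a $ 0 = 0"
  by (simp add: log_partition_nth log_partition_term_nth_eq_0)

section \<open>The operators\<close>

text \<open>Multiplication by \<open>x\<close> leaves the power series in \<open>x\<inverse>\<close>, so the operators act on Laurent series
  in \<open>x\<inverse>\<close>; there \<open>fls_X\<close> is \<open>x\<inverse>\<close> and \<open>fls_X_inv\<close> is \<open>x\<close>. The factor in \<open>ddx\<close> is the derivative of
  \<open>x\<inverse>\<close> with respect to \<open>x\<close>.\<close>

definition ddx :: "hbar_laurent fls \<Rightarrow> hbar_laurent fls" where
  "ddx f = - (fls_X ^ 2) * fls_deriv f"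

text \<open>A Laurent series \<open>f\<close> represents the product of \<open>f\<close> with the formal symbol
  \<open>s\<close>, the power of \<open>x\<close> with exponent \<open>- 1 / \<hbar>\<close>. Since the derivative of \<open>s\<close> is
  \<open>- \<hbar>\<inverse> s x\<inverse>\<close>, Leibniz' rule gives \<open>s\<inverse> (\<partial> / \<partial>x) s\<close>, and hence \<open>s\<inverse> y s\<close> for
  \<open>y = - \<hbar> (\<partial> / \<partial>x)\<close>; multiplication by \<open>x\<close> commutes with \<open>s\<close>.\<close>

definition ddx_conj :: "hbar_laurent fls \<Rightarrow> hbar_laurent fls" where
  "ddx_conj f = ddx f - fls_const (hbar_monom 1 (-1)) * fls_X * f"

definition y_hat :: "hbar_laurent fls \<Rightarrow> hbar_laurent fls" where
  "y_hat f = - fls_const (hbar_monom 1 1) * ddx_conj f"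

definition x_hat :: "hbar_laurent fls \<Rightarrow> hbar_laurent fls" where
  "x_hat f = fls_X_inv * f"

lemma y_hat_eq: "y_hat f = - fls_const (hbar_monom 1 1) * ddx f + fls_X * f"
proof -
  have *: "fls_const (hbar_monom 1 1) * fls_const (hbar_monom 1 (-1)) = 1"
    by (simp add: hbar_monom_def fls_const_mult_const mult_single)
  have "y_hat f = - fls_const (hbar_monom 1 1) * ddx f
      + (fls_const (hbar_monom 1 1) * fls_const (hbar_monom 1 (-1))) * (fls_X * f)"
    by (simp add: y_hat_def ddx_conj_def algebra_simps)
  then show ?thesis by (simp only: * mult_1_left)
qed

end

theory Submission
  imports Defs "HOL-Combinatorics.Multiset_Permutations"
begin

text \<open>
The coefficients of the partition function can be computed in closed form, and the differential
equation is the two-term recursion that they satisfy.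

In the logarithm of \<open>Zbar\<close>, the coefficient at the power \<open>- d\<close> of \<open>x\<close> collects all triples
\<open>(\<sigma>0, \<sigma>1, \<sigma>2)\<close> of permutations of \<open>d\<close> points. Weighting a class by the reciprocal of its number of
automorphisms amounts to counting triples and dividing by \<open>d!\<close> (\<open>hypermap_count_eq_card\<close>). The
permutation \<open>\<sigma>2\<close> is determined by the other two, and the \<open>n!\<close> labellings of its cycles cancel the
factor \<open>1 / n!\<close> of the free energies. By Riemann-Hurwitz the exponent \<open>2 g - 2 + n\<close> of \<open>\<hbar>\<close> is
\<open>(a - 1) c(\<sigma>1) - c(\<sigma>0)\<close>, where \<open>c\<close> is the number of cycles, and so mentions neither \<open>g\<close> nor
\<open>\<sigma>2\<close>. Conversely every transitive pair \<open>(\<sigma>0, \<sigma>1)\<close> with all cycles of \<open>\<sigma>1\<close> of length \<open>a\<close> occurs in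
the sum, because the genus that Riemann-Hurwitz assigns to it is a natural number
(\<open>euler_characteristic\<close>). Hence \<open>log Zbar\<close> is the exponential generating function of these
transitive pairs with a weight that is multiplicative over components
(\<open>log_partition_nth_transitive\<close>).

By the exponential formula (\<open>pair_sum_Suc\<close>), \<open>Zbar\<close> is the generating function of all pairs,
transitive or not. Now \<open>\<sigma>0\<close> and \<open>\<sigma>1\<close> are independent. Summing \<open>\<hbar>\<close> to the power \<open>- c(\<sigma>0)\<close> over all
permutations gives the rising factorial \<open>t (t + 1) \<dots> (t + d - 1)\<close> at \<open>t = 1 / \<hbar>\<close>, and for
\<open>d = a m\<close> there are \<open>d! / (a\<^sup>m m!)\<close> choices for \<open>\<sigma>1\<close>, which have \<open>m\<close> cycles each.

With the factor \<open>x\<close> to the power \<open>- 1 / \<hbar>\<close> in front, \<open>y\<close> multiplies the term of degree \<open>- k\<close> by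
\<open>\<hbar> (k + 1 / \<hbar>)\<close> and lowers its degree by one. Hence \<open>y\<close> to the power \<open>a\<close> supplies exactly the \<open>a\<close>
factors by which the next rising factorial is longer, while \<open>1 - x y\<close> multiplies the term of degree
\<open>- k\<close> by \<open>- k \<hbar>\<close>, which accounts for the denominators \<open>a\<^sup>m m!\<close>. The two contributions cancel.
\<close>

section \<open>Joint orbits of a set of permutations\<close>

text \<open>Connectedness enters in three ways: the cycles of a permutation, the transitivity of a pair, and
the component of a point under a pair. All three are classes of one relation, the equivalence
generated by the graphs of a set of functions, so that a cycle of \<open>p\<close> is a class of \<open>linked {p}\<close>.
The graphs are taken in both directions so that the relation is symmetric by construction.\<close>

definition linked :: "('a \<Rightarrow> 'a) set \<Rightarrow> ('a \<times> 'a) set" where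
  "linked P = (\<Union>p\<in>P. {(x, p x) | x. True} \<union> {(p x, x) | x. True})\<^sup>*"

lemma linked_refl [simp, intro]: "(x, x) \<in> linked P"
  by (simp add: linked_def)

lemma linked_trans [trans]: "(x, y) \<in> linked P \<Longrightarrow> (y, z) \<in> linked P \<Longrightarrow> (x, z) \<in> linked P"
  unfolding linked_def by (rule rtrancl_trans)

lemma linked_sym: "(x, y) \<in> linked P \<Longrightarrow> (y, x) \<in> linked P"
  unfolding linked_def
  by (rule symD[OF sym_rtrancl]) (auto simp: sym_def)

lemma linked_step: "p \<in> P \<Longrightarrow> (x, p x) \<in> linked P"
  unfolding linked_def by (rule r_into_rtrancl) blast

text \<open>Contrary to \<open>rtrancl_induct\<close> this forgets the path and keeps only the
closure of \<open>Q\<close> under the functions and their preimages, which is all that is ever needed.\<close>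

lemma linked_induct [consumes 1, case_names refl step unstep]:
  assumes "(x, y) \<in> linked P" "Q x"
    and "\<And>p z. p \<in> P \<Longrightarrow> Q z \<Longrightarrow> Q (p z)"
    and "\<And>p z. p \<in> P \<Longrightarrow> Q (p z) \<Longrightarrow> Q z"
  shows "Q y"
  using assms(1) unfolding linked_def
  by (induction rule: rtrancl_induct) (use assms in auto)

lemma linked_le:
  assumes "(x, y) \<in> linked P" "\<And>p z. p \<in> P \<Longrightarrow> (z, p z) \<in> linked Q"
  shows "(x, y) \<in> linked Q"
  using assms(1)
proof (induction rule: linked_induct)
  case (step p z)
  then show ?case using linked_trans[OF step(2) assms(2)] by blast
next
  case (unstep p z)
  then show ?case using linked_trans[OF unstep(2) linked_sym[OF assms(2)[OF unstep(1)]]] by blast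
qed auto

lemma linked_mono: "P \<subseteq> Q \<Longrightarrow> (x, y) \<in> linked P \<Longrightarrow> (x, y) \<in> linked Q"
  by (erule linked_le) (rule linked_step, blast)

lemma linked_class_eq: "linked P `` {x} = linked P `` {y} \<longleftrightarrow> (x, y) \<in> linked P"
proof
  assume "linked P `` {x} = linked P `` {y}"
  moreover have "y \<in> linked P `` {y}" by simp
  ultimately show "(x, y) \<in> linked P" by blast
next
  assume xy: "(x, y) \<in> linked P"
  show "linked P `` {x} = linked P `` {y}"
    using linked_trans[OF xy] linked_trans[OF linked_sym[OF xy]] by blast
qed

text \<open>Unfolding this turns statements about linked points into equational logic, where the simplifier
needs neither symmetry nor transitivity.\<close>

lemma linked_iff: "(x, y) \<in> linked P \<longleftrightarrow> linked P `` {x} = linked P `` {y}"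
  by (simp add: linked_class_eq)

text \<open>An injection that maps a finite set into itself maps it onto itself, so such a set is also closed
under preimages. This is how two points are shown not to be linked.\<close>

lemma linked_preserves_finite:
  assumes "(x, y) \<in> linked P" "x \<in> S" "finite S"
    and "\<And>p. p \<in> P \<Longrightarrow> inj p" "\<And>p z. p \<in> P \<Longrightarrow> z \<in> S \<Longrightarrow> p z \<in> S"
  shows "y \<in> S"
  using assms(1,2)
proof (induction rule: linked_induct)
  case (step p z)
  then show ?case using assms by blast
next
  case (unstep p z)
  have "p ` S = S"
    using assms(3,5) inj_on_subset[OF assms(4)[OF unstep(1)]] unstep(1) by (intro endo_inj_surj) auto
  then obtain w where "w \<in> S" "p w = p z" using unstep by (metis imageE)
  then show ?case using injD[OF assms(4)[OF unstep(1)]] by blast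
qed auto

lemma linked_permutes:
  assumes "(x, y) \<in> linked P" "\<And>p. p \<in> P \<Longrightarrow> p permutes A"
  shows "x \<in> A \<longleftrightarrow> y \<in> A"
  using assms(1) by (induction rule: linked_induct) (use assms in \<open>auto simp: permutes_in_image\<close>)

definition blocks :: "'a set \<Rightarrow> ('a \<Rightarrow> 'a) set \<Rightarrow> 'a set set" where
  "blocks A P = (\<lambda>x. linked P `` {x}) ` A"

lemma finite_blocks [simp]: "finite A \<Longrightarrow> finite (blocks A P)"
  by (simp add: blocks_def)

lemma blocks_cong: "linked P = linked Q \<Longrightarrow> blocks A P = blocks A Q"
  by (simp add: blocks_def)

text \<open>A transposition is an edge of the graph whose components are the classes: adding it to \<open>P\<close>
joins the classes of its two points and does nothing else.\<close>

lemma linked_insert_transpose_iff: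
  "(u, v) \<in> linked (insert (transpose x y) P) \<longleftrightarrow>
     (u, v) \<in> linked P \<or> (u, x) \<in> linked P \<and> (y, v) \<in> linked P \<or> (u, y) \<in> linked P \<and> (x, v) \<in> linked P"
  (is "?l \<longleftrightarrow> ?r v")
proof
  \<comment> \<open>the right-hand side is invariant under linked steps and under the transposition\<close>
  have cong: "?r w" if "?r z" "(z, w) \<in> linked P" for z w
    using that by (blast intro: linked_trans)
  have swap: "?r (transpose x y z)" if "?r z" for z
    using that by (cases "z = x"; cases "z = y") auto
  assume ?l
  then show "?r v"
  proof (induction rule: linked_induct)
    case (step p z)
    then show ?case using cong[OF step(2)] swap[OF step(2)] linked_step by (metis insertE)
  next
    case (unstep p z)
    show ?case
    proof (cases "p = transpose x y")
      case True
      then show ?thesis using swap[OF unstep(2)] by simp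
    next
      case False
      then have "(p z, z) \<in> linked P" using unstep(1) linked_step[of p P z] by (simp add: linked_sym)
      then show ?thesis using cong[OF unstep(2)] by blast
    qed
  qed simp
next
  assume r: "?r v"
  have xy: "(x, y) \<in> linked (insert (transpose x y) P)"
    using linked_step[of "transpose x y" "insert (transpose x y) P" x] by simp
  have m: "(s, t) \<in> linked P \<Longrightarrow> (s, t) \<in> linked (insert (transpose x y) P)" for s t
    by (erule linked_mono[rotated]) auto
  show ?l using r
  proof (elim disjE conjE)
    assume "(u, x) \<in> linked P" "(y, v) \<in> linked P"
    then show ?l using m xy by (blast intro: linked_trans)
  next
    assume "(u, y) \<in> linked P" "(x, v) \<in> linked P"
    then show ?l using m linked_sym[OF xy] by (blast intro: linked_trans)
  qed (rule m)
qed

lemma linked_insert_transpose_same: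
  "(x, y) \<in> linked P \<Longrightarrow> linked (insert (transpose x y) P) = linked P"
proof (rule Set.set_eqI)
  fix e assume "(x, y) \<in> linked P"
  then show "e \<in> linked (insert (transpose x y) P) \<longleftrightarrow> e \<in> linked P"
    by (cases e) (simp only: linked_insert_transpose_iff linked_iff[of _ _ P], blast)
qed

text \<open>The two old classes are distinct members of the old partition, their union is new, and nothing
else changes.\<close>

lemma card_blocks_merge:
  assumes "finite A" "x \<in> A" "y \<in> A" "(x, y) \<notin> linked P"
  shows "card (blocks A P) = Suc (card (blocks A (insert (transpose x y) P)))"
proof -
  let ?X = "linked P `` {x}" and ?Y = "linked P `` {y}"
  let ?Q = "insert (transpose x y) P"
  have XY: "?X \<noteq> ?Y" using assms(4) by (simp add: linked_class_eq)
  have inb: "?X \<in> blocks A P" "?Y \<in> blocks A P" using assms by (auto simp: blocks_def)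
  have merged: "linked ?Q `` {u} = ?X \<union> ?Y" if "u \<in> ?X \<union> ?Y" for u
  proof (rule Set.set_eqI)
    fix v show "v \<in> linked ?Q `` {u} \<longleftrightarrow> v \<in> ?X \<union> ?Y"
      using that unfolding Un_iff Image_singleton_iff linked_insert_transpose_iff
      unfolding linked_iff[of _ _ P] by auto
  qed
  have kept: "linked ?Q `` {u} = linked P `` {u}" if "u \<notin> ?X \<union> ?Y" for u
  proof (rule Set.set_eqI)
    fix v show "v \<in> linked ?Q `` {u} \<longleftrightarrow> v \<in> linked P `` {u}"
      using that unfolding Un_iff Image_singleton_iff linked_insert_transpose_iff
      unfolding linked_iff[of _ _ P] by auto
  qed
  have old: "linked P `` {u} = ?X \<or> linked P `` {u} = ?Y \<longleftrightarrow> u \<in> ?X \<union> ?Y" for u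
    unfolding Un_iff Image_singleton_iff unfolding linked_iff[of _ _ P] by auto
  have "blocks A ?Q = insert (?X \<union> ?Y) (blocks A P - {?X, ?Y})"
  proof (intro equalityI subsetI)
    fix B assume "B \<in> blocks A ?Q"
    then obtain u where u: "u \<in> A" "B = linked ?Q `` {u}" by (auto simp: blocks_def)
    show "B \<in> insert (?X \<union> ?Y) (blocks A P - {?X, ?Y})"
    proof (cases "u \<in> ?X \<union> ?Y")
      case True
      then show ?thesis using merged u by blast
    next
      case False
      then show ?thesis using kept[OF False] old[of u] u by (auto simp: blocks_def)
    qed
  next
    fix B assume "B \<in> insert (?X \<union> ?Y) (blocks A P - {?X, ?Y})"
    then consider "B = ?X \<union> ?Y" | u where "u \<in> A" "B = linked P `` {u}" "B \<noteq> ?X" "B \<noteq> ?Y"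
      by (auto simp: blocks_def)
    then show "B \<in> blocks A ?Q"
    proof cases
      case 1
      then show ?thesis using merged[of x] assms(2) by (auto simp: blocks_def)
    next
      case 2
      then show ?thesis using kept[of u] old[of u] by (auto simp: blocks_def)
    qed
  qed
  moreover have "?X \<union> ?Y \<notin> blocks A P - {?X, ?Y}"
  proof
    assume "?X \<union> ?Y \<in> blocks A P - {?X, ?Y}"
    then obtain u where "?X \<union> ?Y = linked P `` {u}" by (auto simp: blocks_def)
    then have "(u, x) \<in> linked P" "(u, y) \<in> linked P" by blast+
    then show False using assms(4) by (simp add: linked_iff[of _ _ P])
  qed
  moreover have "card (blocks A P - {?X, ?Y}) = card (blocks A P) - 2"
    using XY inb assms(1) by (subst card_Diff_subset) auto
  moreover have "card (blocks A P) \<ge> 2"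
    using card_mono[of "blocks A P" "{?X, ?Y}"] XY inb assms(1) by auto
  ultimately show ?thesis using assms(1) by simp
qed

section \<open>Transpositions join and split cycles\<close>

lemma finite_period:
  assumes "p permutes A" "finite A"
  obtains m where "m > 0" "(p ^^ m) x = x" "\<And>j. 0 < j \<Longrightarrow> j < m \<Longrightarrow> (p ^^ j) x \<noteq> x"
proof -
  have "permutation p" using assms permutes_imp_permutation by blast
  then have "x \<in> orbit p x" by (rule permutation_self_in_orbit)
  then have ex: "\<exists>n. 0 < n \<and> (p ^^ n) x = x" by (auto simp: orbit_altdef)
  show thesis
    by (rule that[of "LEAST n. 0 < n \<and> (p ^^ n) x = x"])
      (use LeastI_ex[OF ex] not_less_Least[of _ "\<lambda>n. 0 < n \<and> (p ^^ n) x = x"] in auto)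
qed

lemma linked_funpow: "p \<in> P \<Longrightarrow> (x, (p ^^ n) x) \<in> linked P"
  by (induction n) (auto intro: linked_trans linked_step)

text \<open>On a finite set the inverse of a permutation is one of its powers, so following arrows backwards
reaches nothing new.\<close>

lemma linked_singleton_orbit:
  assumes "p permutes A" "finite A"
  shows "linked {p} `` {x} = orbit p x"
proof (intro equalityI subsetI)
  have perm: "permutation p" using assms permutes_imp_permutation by blast
  fix y assume "y \<in> linked {p} `` {x}"
  then have "(x, y) \<in> linked {p}" by simp
  then show "y \<in> orbit p x"
  proof (induction rule: linked_induct)
    case refl
    then show ?case by (rule permutation_self_in_orbit[OF perm])
  next
    case (step q z)
    then show ?case by (auto intro: orbit.step)
  next
    case (unstep q z)
    have "z \<in> orbit p (p z)"
      using permutation_self_in_orbit[OF perm, of z] permutation_orbit_step[OF perm, of z] by simp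
    then show ?case using unstep orbit_trans by fastforce
  qed
next
  fix y assume "y \<in> orbit p x"
  then show "y \<in> linked {p} `` {x}"
    by (auto simp: orbit_altdef intro: linked_funpow)
qed

text \<open>Multiplying by a transposition of two points in different cycles has the effect of adding an edge
between them. The point is that \<open>x\<close> and \<open>y\<close> are still linked afterwards: starting at \<open>x\<close>, the
product follows the cycle of \<open>p\<close> (which avoids \<open>y\<close>) until the step that would return to \<open>x\<close>, and
this step is redirected to \<open>y\<close>.\<close>

lemma linked_transpose_comp:
  assumes p: "p permutes A" "finite A" and xy: "(x, y) \<notin> linked {p}"
  shows "linked {transpose x y \<circ> p} = linked {transpose x y, p}"
proof -
  let ?q = "transpose x y \<circ> p"
  have ex: "(x, y) \<in> linked {transpose x' y' \<circ> p}"
    if "(x, y) \<notin> linked {p}" "transpose x' y' = transpose x y" for x y x' y'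
  proof -
    let ?q = "transpose x y \<circ> p"
    obtain m where m: "m > 0" "(p ^^ m) x = x" "\<And>j. 0 < j \<Longrightarrow> j < m \<Longrightarrow> (p ^^ j) x \<noteq> x"
      using finite_period[OF p] by blast
    have "(x, (p ^^ j) x) \<in> linked {?q}" if "j < m" for j
      using that
    proof (induction j)
      case (Suc j)
      have "(p ^^ Suc j) x \<noteq> y" using linked_funpow[of p "{p}" x "Suc j"] \<open>(x, y) \<notin> linked {p}\<close> by auto
      then have "?q ((p ^^ j) x) = (p ^^ Suc j) x"
        using m(3)[of "Suc j"] Suc.prems by (simp add: transpose_apply_other)
      then have "((p ^^ j) x, (p ^^ Suc j) x) \<in> linked {?q}"
        using linked_step[of ?q "{?q}" "(p ^^ j) x"] by simp
      then show ?case using Suc.prems by (simp only: linked_trans[OF Suc.IH] Suc_lessD)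
    qed auto
    \<comment> \<open>the last point before the cycle closes; its image \<open>x\<close> is moved to \<open>y\<close>\<close>
    from this[of "m - 1"] have "(x, (p ^^ (m - 1)) x) \<in> linked {?q}" using m by simp
    moreover have "?q ((p ^^ (m - 1)) x) = y"
      using m(1,2) by (cases m) auto
    ultimately have "(x, y) \<in> linked {?q}"
      using linked_step[of ?q "{?q}" "(p ^^ (m - 1)) x"] linked_trans by fastforce
    then show ?thesis using that(2) by simp
  qed
  have xyq: "(x, y) \<in> linked {?q}" using ex[OF xy refl] .
  have t: "(z, transpose x y z) \<in> linked {?q}" for z
    using xyq linked_sym by (cases "z = x"; cases "z = y") auto
  have pz: "(z, p z) \<in> linked {?q}" for z
    using linked_trans[OF linked_step[of ?q "{?q}" z] t[of "?q z"]] by simp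
  show ?thesis
  proof (intro equalityI subrelI)
    fix u v assume "(u, v) \<in> linked {?q}"
    then show "(u, v) \<in> linked {transpose x y, p}"
    proof (rule linked_le)
      fix r z assume "r \<in> {?q}"
      then show "(z, r z) \<in> linked {transpose x y, p}"
        using linked_trans[OF linked_step[of p "{transpose x y, p}" z]
          linked_step[of "transpose x y" "{transpose x y, p}" "p z"]] by simp
    qed
  next
    fix u v assume "(u, v) \<in> linked {transpose x y, p}"
    then show "(u, v) \<in> linked {?q}" by (rule linked_le) (use t pz in auto)
  qed
qed

text \<open>If \<open>y\<close> is the first occurrence \<open>(p ^^ k) x\<close> on the cycle of \<open>x\<close>, the product walks from \<open>x\<close> to
\<open>(p ^^ (k - 1)) x\<close> and then jumps to \<open>x\<close> again; the points passed on the way form a finite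
invariant set without \<open>y\<close>.\<close>

lemma not_linked_transpose_comp:
  assumes p: "p permutes A" "finite A" and xy: "(x, y) \<in> linked {p}" "x \<noteq> y"
  shows "(x, y) \<notin> linked {transpose x y \<circ> p}"
proof -
  let ?q = "transpose x y \<circ> p"
  obtain m where m: "m > 0" "(p ^^ m) x = x" "\<And>j. 0 < j \<Longrightarrow> j < m \<Longrightarrow> (p ^^ j) x \<noteq> x"
    using finite_period[OF p] by blast
  have "y \<in> orbit p x" using xy linked_singleton_orbit[OF p] by blast
  then have ex: "\<exists>n. (p ^^ n) x = y" by (auto simp: orbit_altdef) 
  define k where "k = (LEAST n. (p ^^ n) x = y)"
  have k: "(p ^^ k) x = y" "\<And>j. j < k \<Longrightarrow> (p ^^ j) x \<noteq> y"
    using LeastI_ex[OF ex] not_less_Least[of _ "\<lambda>n. (p ^^ n) x = y"] by (auto simp: k_def)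
  have k0: "k > 0" using k xy by (cases k) auto
  \<comment> \<open>otherwise \<open>y\<close> would already occur one period earlier\<close>
  have km: "k < m"
  proof (rule ccontr)
    assume "\<not> k < m"
    then have "(p ^^ k) x = (p ^^ (k - m)) ((p ^^ m) x)"
      by (metis comp_apply funpow_add le_add_diff_inverse2 not_less)
    then show False using k(1) k(2)[of "k - m"] m(1,2) k0 by auto
  qed
  let ?S = "(\<lambda>j. (p ^^ j) x) ` {..<k}"
  show ?thesis
  proof
    assume "(x, y) \<in> linked {?q}"
    then have "y \<in> ?S"
    proof (rule linked_preserves_finite)
      show x0: "x \<in> ?S" using k0 by (intro image_eqI[of _ _ 0]) auto
      fix r assume "r \<in> {?q}"
      then show "inj r" using permutes_inj[OF p(1)] by (auto intro: inj_compose)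
      fix z assume "z \<in> ?S"
      then obtain j where j: "j < k" "z = (p ^^ j) x" by auto
      show "r z \<in> ?S"
      proof (cases "Suc j = k")
        case True
        then have "r z = x" using \<open>r \<in> _\<close> j k(1) by auto
        then show ?thesis using x0 by simp
      next
        case False
        then have "r z = (p ^^ Suc j) x"
          using \<open>r \<in> _\<close> j k(2)[of "Suc j"] m(3)[of "Suc j"] km by (simp add: transpose_apply_other)
        then show ?thesis using False j by (intro image_eqI[of _ _ "Suc j"]) auto
      qed
    qed auto
    then show False using k(2) by auto
  qed
qed

lemma card_blocks_transpose_merge:
  assumes "p permutes A" "finite A" "x \<in> A" "y \<in> A" "(x, y) \<notin> linked {p}"
  shows "card (blocks A {p}) = Suc (card (blocks A {transpose x y \<circ> p}))"
  using card_blocks_merge[OF assms(2-5)]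
    blocks_cong[OF linked_transpose_comp[OF assms(1,2,5)], of A] by simp

lemma card_blocks_transpose_split:
  assumes "p permutes A" "finite A" "x \<in> A" "y \<in> A" "(x, y) \<in> linked {p}" "x \<noteq> y"
  shows "card (blocks A {transpose x y \<circ> p}) = Suc (card (blocks A {p}))"
proof -
  have "transpose x y \<circ> (transpose x y \<circ> p) = p" by (simp add: fun_eq_iff)
  moreover have "transpose x y \<circ> p permutes A"
    using assms by (intro permutes_compose permutes_swap_id)
  ultimately show ?thesis
    using card_blocks_transpose_merge[OF _ assms(2-4) not_linked_transpose_comp[OF assms(1,2,5,6)]]
    by simp
qed

section \<open>The Euler characteristic of a pair of permutations\<close>

lemma linked_insert_cong: "linked P = linked Q \<Longrightarrow> linked (insert r P) = linked (insert r Q)"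
proof -
  have "linked (insert r P) \<subseteq> linked (insert r Q)" if "linked P = linked Q" for P Q
  proof (rule subrelI, erule linked_le)
    fix p z assume "p \<in> insert r P"
    then show "(z, p z) \<in> linked (insert r Q)"
      using linked_step[of p P z] linked_mono[of Q "insert r Q" z "p z"]
        linked_step[of r "insert r Q" z] that by auto
  qed
  then show "linked P = linked Q \<Longrightarrow> ?thesis" by blast
qed

lemma linked_insert_id: "linked (insert id P) = linked P"
proof (intro equalityI subrelI)
  fix x y assume "(x, y) \<in> linked (insert id P)"
  then show "(x, y) \<in> linked P" by (rule linked_le) (auto intro: linked_step)
qed (auto intro: linked_mono[rotated])

lemma linked_id: "linked {id} = Id"
proof -
  have "(x, y) \<in> linked {id} \<Longrightarrow> x = y" for x y :: 'a
    by (induction rule: linked_induct) auto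
  then show ?thesis by auto
qed

lemma card_blocks_id: "card (blocks A {id}) = card A"
  unfolding blocks_def linked_id by (rule card_image) (auto simp: inj_on_def)

text \<open>Riemann-Hurwitz for \<open>(p, q, q \<circ> p)\<close>, with the natural number \<open>g\<close> in the role of the genus (the sum
of the genera of the components). Both the parity and the inequality hidden in it come from
building up \<open>q\<close> from transpositions. A new factor joins two cycles of \<open>q\<close>. If its points were
linked by \<open>p\<close> and the old \<open>q\<close>, then the number of components stays and the cycle count of the
product changes by one in either direction, so that \<open>g\<close> stays or grows by one. If they were not
linked, two components and two cycles of the product are joined, and \<open>g\<close> stays. Induction needs
the support \<open>S\<close> of \<open>q\<close> to vary inside \<open>A\<close>.\<close>

lemma euler_characteristic_aux:
  assumes "finite S" "S \<subseteq> A" "q permutes S" "finite A" "p permutes A"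
  shows "\<exists>g. card (blocks A {p}) + card (blocks A {q}) + card (blocks A {q \<circ> p}) + 2 * g
           = card A + 2 * card (blocks A {p, q})"
  using assms(1-3)
proof (induction S arbitrary: q rule: finite_induct)
  case empty
  then have "q = id" by simp
  moreover have "{p, id} = insert id {p}" by auto
  ultimately show ?case
    using blocks_cong[OF linked_insert_id[of "{p}"], of A]
    by (intro exI[of _ 0]) (simp only: card_blocks_id id_comp mult_0_right)
next
  case (insert x S)
  obtain b q' where q: "q = transpose x b \<circ> q'" "b \<in> insert x S" and q': "q' permutes S"
  proof -
    have "q \<in> {q. q permutes insert x S}" using insert.prems(2) by simp
    then show ?thesis unfolding permutes_insert[of x S] using that by auto
  qed
  obtain g where g: "card (blocks A {p}) + card (blocks A {q'}) + card (blocks A {q' \<circ> p}) + 2 * g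
      = card A + 2 * card (blocks A {p, q'})"
    using insert.IH[OF _ q'] insert.prems(1) by blast
  show ?case
  proof (cases "b = x")
    case True
    then have "q = q'" by (simp add: q)
    then show ?thesis using g by blast
  next
    case False
    let ?t = "transpose x b"
    have xb: "x \<in> A" "b \<in> A" using q insert.prems by auto
    have q'A: "q' permutes A" using permutes_subset[OF q'] insert.prems by auto
    have nl: "(x, b) \<notin> linked {q'}"
      using linked_permutes[of x b "{q'}" S] q' q(2) False insert.hyps by auto
    have cq: "card (blocks A {q'}) = Suc (card (blocks A {q}))"
      unfolding q using card_blocks_transpose_merge[OF q'A \<open>finite A\<close> xb nl] .
    have "linked (insert p {q}) = linked (insert p {?t, q'})"
      unfolding q using linked_insert_cong[OF linked_transpose_comp[OF q'A \<open>finite A\<close> nl]] .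
    moreover have "insert p {?t, q'} = insert ?t {p, q'}" by auto
    ultimately have bq: "blocks A {p, q} = blocks A (insert ?t {p, q'})"
      by (metis blocks_cong)
    have q'p: "q' \<circ> p permutes A" using q'A \<open>p permutes A\<close> by (rule permutes_compose[rotated])
    have qp: "q \<circ> p = ?t \<circ> (q' \<circ> p)" by (simp add: q comp_assoc)
    have merge: "card (blocks A {q' \<circ> p}) = Suc (card (blocks A {q \<circ> p}))"
      if "(x, b) \<notin> linked {q' \<circ> p}"
      unfolding qp using card_blocks_transpose_merge[OF q'p \<open>finite A\<close> xb that] .
    have split: "card (blocks A {q \<circ> p}) = Suc (card (blocks A {q' \<circ> p}))"
      if "(x, b) \<in> linked {q' \<circ> p}"
      unfolding qp using card_blocks_transpose_split[OF q'p \<open>finite A\<close> xb that] False by simp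
    show ?thesis
    proof (cases "(x, b) \<in> linked {p, q'}")
      case True
      then have b: "card (blocks A {p, q}) = card (blocks A {p, q'})"
        using bq blocks_cong[OF linked_insert_transpose_same] by metis
      show ?thesis
      proof (cases "(x, b) \<in> linked {q' \<circ> p}")
        case True
        then show ?thesis using split[OF True] b cq g by (intro exI[of _ g]) linarith
      next
        case False
        then show ?thesis using merge[OF False] b cq g by (intro exI[of _ "g + 1"]) presburger
      qed
    next
      case nl': False
      have nl'': "(x, b) \<notin> linked {q' \<circ> p}"
      proof
        assume "(x, b) \<in> linked {q' \<circ> p}"
        then have "(x, b) \<in> linked {p, q'}"
        proof (rule linked_le)
          fix r z assume "r \<in> {q' \<circ> p}"
          then show "(z, r z) \<in> linked {p, q'}"
            using linked_trans[OF linked_step[of p "{p, q'}" z] linked_step[of q' "{p, q'}" "p z"]]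
            by simp
        qed
        then show False using nl' by blast
      qed
      have "card (blocks A {p, q'}) = Suc (card (blocks A {p, q}))"
        unfolding bq using card_blocks_merge[OF \<open>finite A\<close> xb nl'] .
      then show ?thesis using merge[OF nl''] cq g by (intro exI[of _ g]) linarith
    qed
  qed
qed

lemma euler_characteristic:
  assumes "finite A" "p permutes A" "q permutes A"
  shows "\<exists>g. card (blocks A {p}) + card (blocks A {q}) + card (blocks A {q \<circ> p}) + 2 * g
           = card A + 2 * card (blocks A {p, q})"
  using euler_characteristic_aux[of A A q p] assms by blast

section \<open>Counting permutations by their cycles\<close>

lemma linked_fixed_point:
  assumes "q permutes A" "x \<notin> A"
  shows "linked {q} `` {x} = {x}"
proof -
  have "y = x" if "(x, y) \<in> linked {q}" for y
    using linked_preserves_finite[OF that, of "{x}"] assms permutes_inj permutes_not_in[OF assms]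
    by auto
  then show ?thesis by auto
qed

lemma card_blocks_insert_fixed:
  assumes "finite A" "x \<notin> A" "q permutes A"
  shows "card (blocks (insert x A) {q}) = Suc (card (blocks A {q}))"
proof -
  have "{x} \<notin> blocks A {q}"
    using assms(2) linked_refl by (fastforce simp: blocks_def)
  moreover have "blocks (insert x A) {q} = insert {x} (blocks A {q})"
    by (simp add: blocks_def linked_fixed_point[OF assms(3,2)])
  ultimately show ?thesis using assms(1) by simp
qed

lemma card_blocks_insert_transpose:
  assumes "finite A" "x \<notin> A" "q permutes A" "b \<in> A"
  shows "card (blocks (insert x A) {transpose x b \<circ> q}) = card (blocks A {q})"
proof -
  have "(x, b) \<notin> linked {q}"
    using linked_fixed_point[OF assms(3,2)] assms(2,4) by auto
  then have "card (blocks (insert x A) {q}) = Suc (card (blocks (insert x A) {transpose x b \<circ> q}))"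
    using assms by (intro card_blocks_transpose_merge[of _ "insert x A"]) (auto intro: permutes_subset)
  then show ?thesis using card_blocks_insert_fixed[OF assms(1-3)] by simp
qed

text \<open>A permutation of \<open>insert x A\<close> arises from one of \<open>A\<close> either by adding \<open>x\<close> as a fixed point, which
is a new cycle, or by inserting \<open>x\<close> next to one of the elements of \<open>A\<close> into an existing cycle.\<close>

lemma sum_permutations_insert_by_cycles:
  fixes f :: "nat \<Rightarrow> 'r :: comm_semiring_1"
  assumes "finite A" "x \<notin> A"
  shows "(\<Sum>p | p permutes insert x A. f (card (blocks (insert x A) {p})))
       = (\<Sum>p | p permutes A. f (Suc (card (blocks A {p})))) + of_nat (card A) * (\<Sum>p | p permutes A. f (card (blocks A {p})))"
  using assms
  by (simp add: sum_over_permutations_insert card_blocks_insert_fixed card_blocks_insert_transpose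
      flip: sum_constant)

lemma sum_permutations_power_cycles:
  fixes t :: "'r :: comm_semiring_1"
  assumes "finite A"
  shows "(\<Sum>p | p permutes A. t ^ card (blocks A {p})) = pochhammer t (card A)"
  using assms
proof (induction A rule: finite_induct)
  case empty
  then show ?case by (simp add: blocks_def)
next
  case (insert x A)
  show ?case
    by (simp only: sum_permutations_insert_by_cycles[OF insert.hyps, of "\<lambda>n. t ^ n"] insert.IH
        power_Suc flip: sum_distrib_left)
      (simp add: insert.hyps pochhammer_Suc algebra_simps)
qed

lemma card_blocks_pos: "finite A \<Longrightarrow> A \<noteq> {} \<Longrightarrow> card (blocks A P) > 0"
  by (simp add: blocks_def card_gt_0_iff)

lemma sum_cyclic_permutations:
  assumes "finite A" "A \<noteq> {}"
  shows "(\<Sum>p | p permutes A. if card (blocks A {p}) = 1 then 1 else 0)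
       = (fact (card A - 1) :: 'r :: {comm_semiring_1, semiring_char_0})"
  using assms
proof (induction A rule: finite_ne_induct)
  case (singleton x)
  have "{p. p permutes {x}} = {id}" by auto
  then show ?case using card_blocks_id[of "{x}"] by (simp del: id_apply add: id_def)
next
  case (insert x A)
  have "(\<Sum>p | p permutes A. if Suc (card (blocks A {p})) = 1 then 1 else 0) = (0 :: 'r)"
    using card_blocks_pos[OF insert.hyps(1,2)] by (simp add: less_imp_neq[THEN not_sym])
  then show ?case
    using sum_permutations_insert_by_cycles[OF insert.hyps(1,3), of "\<lambda>n. if n = 1 then 1 else 0 :: 'r"]
      insert card_gt_0_iff[of A]
    by (simp add: fact_reduce[of "card A"])
qed

section \<open>Splitting off the component of a point\<close>

lemma linked_transfer:
  assumes "(x, y) \<in> linked {p, q}" "x \<in> C"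
    and "\<And>z. p z \<in> C \<longleftrightarrow> z \<in> C" "\<And>z. q z \<in> C \<longleftrightarrow> z \<in> C"
    and "\<And>z. z \<in> C \<Longrightarrow> p' z = p z" "\<And>z. z \<in> C \<Longrightarrow> q' z = q z"
  shows "(x, y) \<in> linked {p', q'}"
proof -
  have pz: "(z, p z) \<in> linked {p', q'}" if "z \<in> C" for z
    using linked_step[of p' "{p', q'}" z] assms(5)[OF that] by simp
  have qz: "(z, q z) \<in> linked {p', q'}" if "z \<in> C" for z
    using linked_step[of q' "{p', q'}" z] assms(6)[OF that] by simp
  have "y \<in> C \<and> (x, y) \<in> linked {p', q'}"
    using assms(1)
  proof (induction rule: linked_induct)
    case refl
    then show ?case using assms by simp
  next
    case (step r z)
    then show ?case using assms(3,4) linked_trans[OF _ pz] linked_trans[OF _ qz] by blast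
  next
    case (unstep r z)
    then show ?case
      using assms(3,4) linked_trans[OF _ linked_sym[OF pz]] linked_trans[OF _ linked_sym[OF qz]]
      by blast
  qed
  then show ?thesis ..
qed

lemma perm_restrict_permutes:
  assumes "p permutes A" "C \<subseteq> A" "finite A" "\<And>z. z \<in> C \<Longrightarrow> p z \<in> C"
  shows "perm_restrict p C permutes C"
proof -
  have "p ` C = C"
    using assms finite_subset permutes_inj_on[OF assms(1), of C] by (intro endo_inj_surj) auto
  then have "bij_betw p C C" using permutes_inj_on[OF assms(1), of C] by (simp add: bij_betw_def)
  then have "bij_betw (perm_restrict p C) C C"
    by (rule bij_betw_cong[THEN iffD1, rotated]) (simp add: perm_restrict_def)
  then show ?thesis by (rule bij_imp_permutes) (simp add: perm_restrict_def)
qed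

lemma disjoint_permutes_simps:
  assumes "p permutes B" "p' permutes D" "B \<inter> D = {}"
  shows "z \<in> B \<Longrightarrow> (p \<circ> p') z = p z" "z \<in> D \<Longrightarrow> (p \<circ> p') z = p' z"
    "z \<notin> B \<Longrightarrow> z \<notin> D \<Longrightarrow> (p \<circ> p') z = z" "(p \<circ> p') z \<in> B \<longleftrightarrow> z \<in> B" "(p \<circ> p') z \<in> D \<longleftrightarrow> z \<in> D"
proof -
  have 1: "(p \<circ> p') z = p z" if "z \<in> B" for z
    using that assms(3) permutes_not_in[OF assms(2), of z] by (auto simp: disjoint_iff)
  have 2: "(p \<circ> p') z = p' z" if "z \<in> D" for z
    using that assms(3) permutes_in_image[OF assms(2), of z] permutes_not_in[OF assms(1), of "p' z"]
    by (auto simp: disjoint_iff)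
  have 3: "(p \<circ> p') z = z" if "z \<notin> B" "z \<notin> D" for z
    using that permutes_not_in[OF assms(1)] permutes_not_in[OF assms(2)] by simp
  show "z \<in> B \<Longrightarrow> (p \<circ> p') z = p z" "z \<in> D \<Longrightarrow> (p \<circ> p') z = p' z"
    "z \<notin> B \<Longrightarrow> z \<notin> D \<Longrightarrow> (p \<circ> p') z = z"
    using 1 2 3 by blast+
  show "(p \<circ> p') z \<in> B \<longleftrightarrow> z \<in> B" "(p \<circ> p') z \<in> D \<longleftrightarrow> z \<in> D"
    using 1[of z] 2[of z] 3[of z] assms(3) permutes_in_image[OF assms(1), of z]
      permutes_in_image[OF assms(2), of z]
    by (cases "z \<in> B"; cases "z \<in> D"; auto)+
qed

text \<open>The composition of permutations of disjoint sets acts on each of them like its own factor.\<close>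

lemma linked_class_disjoint_comp:
  assumes "p permutes B" "q permutes B" "p' permutes D" "q' permutes D" "B \<inter> D = {}" "x \<in> B"
  shows "linked {p \<circ> p', q \<circ> q'} `` {x} = linked {p, q} `` {x}"
proof (intro equalityI subsetI; clarify)
  note simps = disjoint_permutes_simps[OF assms(1,3,5)] disjoint_permutes_simps[OF assms(2,4,5)]
  fix y
  show "(x, y) \<in> linked {p, q}" if "(x, y) \<in> linked {p \<circ> p', q \<circ> q'}"
    by (rule linked_transfer[OF that \<open>x \<in> B\<close>]) (simp_all only: simps)
  show "(x, y) \<in> linked {p \<circ> p', q \<circ> q'}" if "(x, y) \<in> linked {p, q}"
    by (rule linked_transfer[OF that \<open>x \<in> B\<close>])
      (simp_all only: simps permutes_in_image[OF assms(1)] permutes_in_image[OF assms(2)])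
qed

lemma disjoint_comp_commute:
  assumes "p permutes B" "p' permutes D" "B \<inter> D = {}"
  shows "p \<circ> p' = p' \<circ> p"
proof
  fix z
  have "D \<inter> B = {}" using assms by blast
  note s = disjoint_permutes_simps[OF assms, of z] disjoint_permutes_simps[OF assms(2,1) this, of z]
  show "(p \<circ> p') z = (p' \<circ> p) z" using s(1-3,6-8) by (cases "z \<in> B"; cases "z \<in> D") simp_all
qed

lemma blocks_disjoint_comp:
  assumes "p permutes B" "p' permutes D" "B \<inter> D = {}"
  shows "blocks (B \<union> D) {p \<circ> p'} = blocks B {p} \<union> blocks D {p'}" "blocks B {p} \<inter> blocks D {p'} = {}"
proof -
  have 1: "linked {p \<circ> p'} `` {x} = linked {p} `` {x}" if "x \<in> B" for x
    using linked_class_disjoint_comp[OF assms(1,1,2,2,3) that] by simp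
  have 2: "linked {p \<circ> p'} `` {x} = linked {p'} `` {x}" if "x \<in> D" for x
    using linked_class_disjoint_comp[OF assms(2,2,1,1) _ that] assms
    by (simp add: Int_commute disjoint_comp_commute[OF assms])
  show "blocks (B \<union> D) {p \<circ> p'} = blocks B {p} \<union> blocks D {p'}"
    using 1 2 by (auto simp: blocks_def image_Un)
  have "linked {p} `` {x} \<noteq> linked {p'} `` {y}" if "x \<in> B" "y \<in> D" for x y
  proof
    assume eq: "linked {p} `` {x} = linked {p'} `` {y}"
    have "y \<in> linked {p'} `` {y}" by simp
    then have "(x, y) \<in> linked {p}" using eq by blast
    then show False using linked_permutes[of x y "{p}" B] assms that by auto
  qed
  then show "blocks B {p} \<inter> blocks D {p'} = {}" by (auto simp: blocks_def)
qed

text \<open>The weight \<open>F A p q\<close> of a pair may depend on the set that the pair permutes, because the number of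
cycles of a permutation counts its fixed points.\<close>

definition pair_sum ::
  "('a set \<Rightarrow> ('a \<Rightarrow> 'a) \<Rightarrow> ('a \<Rightarrow> 'a) \<Rightarrow> 'r::comm_ring_1) \<Rightarrow> 'a set \<Rightarrow> 'r" where
  "pair_sum F A = (\<Sum>(p, q)\<in>{p. p permutes A} \<times> {q. q permutes A}. F A p q)"

definition transitive_pairs :: "'a set \<Rightarrow> (('a \<Rightarrow> 'a) \<times> ('a \<Rightarrow> 'a)) set" where
  "transitive_pairs A = {(p, q). p permutes A \<and> q permutes A \<and> (\<forall>x\<in>A. \<forall>y\<in>A. (x, y) \<in> linked {p, q})}"

lemma finite_transitive_pairs: "finite A \<Longrightarrow> finite (transitive_pairs A)"
  by (rule finite_subset[of _ "{p. p permutes A} \<times> {q. q permutes A}"])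
    (auto simp: transitive_pairs_def finite_permutations)

definition transitive_pair_sum ::
  "('a set \<Rightarrow> ('a \<Rightarrow> 'a) \<Rightarrow> ('a \<Rightarrow> 'a) \<Rightarrow> 'r::comm_ring_1) \<Rightarrow> 'a set \<Rightarrow> 'r" where
  "transitive_pair_sum F A = (\<Sum>(p, q)\<in>transitive_pairs A. F A p q)"

text \<open>The two properties of a weight that make the exponential formula work: it is multiplicative over
disjoint unions, and it does not see the names of the points.\<close>

locale multiplicative_weight =
  fixes F :: "'a set \<Rightarrow> ('a \<Rightarrow> 'a) \<Rightarrow> ('a \<Rightarrow> 'a) \<Rightarrow> 'r::comm_ring_1"
  assumes mult: "finite B \<Longrightarrow> finite D \<Longrightarrow> B \<inter> D = {} \<Longrightarrow> p permutes B \<Longrightarrow> q permutes B \<Longrightarrow>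
      p' permutes D \<Longrightarrow> q' permutes D \<Longrightarrow> F (B \<union> D) (p \<circ> p') (q \<circ> q') = F B p q * F D p' q'"
    and conj: "bij \<pi> \<Longrightarrow> finite B \<Longrightarrow> p permutes B \<Longrightarrow> q permutes B \<Longrightarrow>
      F (\<pi> ` B) (\<pi> \<circ> p \<circ> Hilbert_Choice.inv \<pi>) (\<pi> \<circ> q \<circ> Hilbert_Choice.inv \<pi>) = F B p q"
begin

text \<open>A pair whose component at \<open>x\<close> is \<open>C\<close> is the same thing as a transitive pair on \<open>C\<close> together with
an arbitrary pair on the complement.\<close>

lemma pair_sum_component:
  assumes "finite A" "C \<subseteq> A" "x \<in> C"
  shows "(\<Sum>(p, q)\<in>{(p, q). p permutes A \<and> q permutes A \<and> linked {p, q} `` {x} = C}. F A p q)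
       = transitive_pair_sum F C * pair_sum F (A - C)"
proof -
  let ?L = "{(p, q). p permutes A \<and> q permutes A \<and> linked {p, q} `` {x} = C}"
  let ?PP = "{p. p permutes (A - C)} \<times> {q. q permutes (A - C)}"
  let ?i = "\<lambda>(p, q). ((perm_restrict p C, perm_restrict q C), (perm_restrict p (A - C), perm_restrict q (A - C)))"
  let ?j = "\<lambda>((p, q), (p', q')). (p \<circ> p', q \<circ> q')"
  have AC: "C \<union> (A - C) = A" "C \<inter> (A - C) = {}" using assms by auto
  have fin: "finite C" "finite (A - C)" using assms finite_subset by auto
  have "transitive_pair_sum F C * pair_sum F (A - C)
      = (\<Sum>((p, q), (p', q'))\<in>transitive_pairs C \<times> ?PP. F C p q * F (A - C) p' q')"
    by (simp add: transitive_pair_sum_def pair_sum_def sum_product sum.cartesian_product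
        case_prod_unfold)
  also have "\<dots> = (\<Sum>(p, q)\<in>?L. F A p q)"
  proof (rule sum.reindex_bij_witness[where i = ?i and j = ?j])
    fix u assume "u \<in> transitive_pairs C \<times> ?PP"
    then obtain p q p' q' where u: "u = ((p, q), (p', q'))" and
      P: "p permutes C" "q permutes C" "p' permutes (A - C)" "q' permutes (A - C)"
      and conn: "\<forall>y\<in>C. \<forall>z\<in>C. (y, z) \<in> linked {p, q}"
      by (auto simp: transitive_pairs_def)
    note s1 = disjoint_permutes_simps[OF P(1,3) AC(2)] 
      and s2 = disjoint_permutes_simps[OF P(2,4) AC(2)]
    have "perm_restrict (p \<circ> p') C = p" "perm_restrict (q \<circ> q') C = q"
      "perm_restrict (p \<circ> p') (A - C) = p'" "perm_restrict (q \<circ> q') (A - C) = q'"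
      using s1 s2 P[THEN permutes_not_in] by (auto simp: perm_restrict_def fun_eq_iff)
    then show "?i (?j u) = u"
      by (simp add: u)
    have "p \<circ> p' permutes A" "q \<circ> q' permutes A"
      using P[THEN permutes_subset, of A] assms(2) by (simp_all add: permutes_compose)
    moreover have "linked {p \<circ> p', q \<circ> q'} `` {x} = C"
      unfolding linked_class_disjoint_comp[OF P AC(2) \<open>x \<in> C\<close>]
    proof (intro equalityI subsetI)
      fix y assume "y \<in> linked {p, q} `` {x}"
      then show "y \<in> C" using linked_permutes[of x y "{p, q}" C] P \<open>x \<in> C\<close> by auto
    qed (use conn \<open>x \<in> C\<close> in auto)
    ultimately show "?j u \<in> ?L"
      by (simp add: u)
    show "(\<lambda>(p, q). F A p q) (?j u) = (\<lambda>((p, q), (p', q')). F C p q * F (A - C) p' q') u"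
      using mult[OF fin AC(2) P] AC(1) by (simp add: u)
  next
    fix w assume "w \<in> ?L"
    then obtain p q where w: "w = (p, q)" and P: "p permutes A" "q permutes A"
      and C: "linked {p, q} `` {x} = C" by auto
    have memC: "y \<in> C \<longleftrightarrow> (x, y) \<in> linked {p, q}" for y using C by blast
    have step: "(z, p z) \<in> linked {p, q}" "(z, q z) \<in> linked {p, q}" for z
      by (simp_all add: linked_step)
    have inC: "p z \<in> C \<longleftrightarrow> z \<in> C" "q z \<in> C \<longleftrightarrow> z \<in> C" for z
      unfolding memC linked_iff[of x] using step[of z] by (simp_all add: linked_iff)
    have res: "perm_restrict p C permutes C" "perm_restrict q C permutes C"
      "perm_restrict p (A - C) permutes (A - C)" "perm_restrict q (A - C) permutes (A - C)"
      using assms P inC by (auto intro!: perm_restrict_permutes[of _ A] simp: permutes_in_image)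
    have conn: "(x, y) \<in> linked {perm_restrict p C, perm_restrict q C}" if "y \<in> C" for y
      by (rule linked_transfer[of _ _ p q C]) (use that inC assms memC in \<open>auto simp: perm_restrict_def\<close>)
    have "(y, z) \<in> linked {perm_restrict p C, perm_restrict q C}" if "y \<in> C" "z \<in> C" for y z
      using linked_trans[OF linked_sym[OF conn] conn] that by blast
    then show "?i w \<in> transitive_pairs C \<times> ?PP"
      using res by (auto simp: w transitive_pairs_def)
    have "perm_restrict p C \<circ> perm_restrict p (A - C) = p"
      "perm_restrict q C \<circ> perm_restrict q (A - C) = q"
      using inC P[THEN permutes_not_in] by (auto simp: perm_restrict_def fun_eq_iff)
    then show "?j (?i w) = w"
      by (simp add: w)
  qed
  finally show ?thesis by simp
qed

lemma pair_sum_decomposition: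
  assumes "finite A" "x \<notin> A"
  shows "pair_sum F (insert x A) = (\<Sum>B\<in>Pow A. transitive_pair_sum F (insert x B) * pair_sum F (A - B))"
proof -
  let ?A = "insert x A"
  let ?P = "{p. p permutes ?A} \<times> {q. q permutes ?A}"
  \<comment> \<open>the component without its base point ranges over all subsets of \<open>A\<close>\<close>
  let ?c = "\<lambda>(p, q). linked {p, q} `` {x} - {x}"
  have sub: "?c ` ?P \<subseteq> Pow A"
    using linked_permutes[of x _ _ ?A] by fastforce
  have "pair_sum F ?A = (\<Sum>B\<in>Pow A. \<Sum>u\<in>{u\<in>?P. ?c u = B}. case u of (p, q) \<Rightarrow> F ?A p q)"
    unfolding pair_sum_def
    by (rule sum.group[symmetric, OF _ _ sub]) (use assms in \<open>auto intro: finite_permutations\<close>)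
  also have "\<dots> = (\<Sum>B\<in>Pow A. transitive_pair_sum F (insert x B) * pair_sum F (A - B))"
  proof (rule sum.cong[OF refl])
    fix B assume B: "B \<in> Pow A"
    then have xB: "x \<notin> B" "?A - insert x B = A - B" using assms by auto
    have "x \<in> linked {p, q} `` {x}" for p q by simp
    then have "linked {p, q} `` {x} - {x} = B \<longleftrightarrow> linked {p, q} `` {x} = insert x B" for p q
      using xB by blast
    then have "{u\<in>?P. ?c u = B} = {(p, q). p permutes ?A \<and> q permutes ?A \<and> linked {p, q} `` {x} = insert x B}"
      by auto
    moreover have "insert x B \<subseteq> ?A" using B by blast
    ultimately show "(\<Sum>u\<in>{u\<in>?P. ?c u = B}. case u of (p, q) \<Rightarrow> F ?A p q)
        = transitive_pair_sum F (insert x B) * pair_sum F (A - B)"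
      using pair_sum_component[of ?A "insert x B" x] assms B xB by simp
  qed
  finally show ?thesis .
qed

end

section \<open>Weighted sums depend only on the cardinality\<close>

abbreviation conj_by :: "('a \<Rightarrow> 'a) \<Rightarrow> ('a \<Rightarrow> 'a) \<Rightarrow> 'a \<Rightarrow> 'a" where
  "conj_by \<pi> p \<equiv> \<pi> \<circ> p \<circ> Hilbert_Choice.inv \<pi>"

lemma conj_by_permutes:
  assumes "bij \<pi>" "p permutes A"
  shows "conj_by \<pi> p permutes \<pi> ` A"
proof (rule bij_imp_permutes)
  have "(conj_by \<pi> p) ` (\<pi> ` A) = \<pi> ` A"
    using assms by (simp add: image_image bij_is_inj permutes_image flip: image_image[of \<pi> p])
  moreover have "inj (conj_by \<pi> p)"
    using assms by (intro inj_compose) (auto intro: bij_is_inj permutes_inj bij_imp_bij_inv)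
  ultimately show "bij_betw (conj_by \<pi> p) (\<pi> ` A) (\<pi> ` A)"
    by (simp add: bij_betw_def inj_on_subset[OF _ subset_UNIV])
  fix x assume "x \<notin> \<pi> ` A"
  then have "Hilbert_Choice.inv \<pi> x \<notin> A"
    using assms(1) by (metis bij_inv_eq_iff imageI)
  then show "conj_by \<pi> p x = x"
    using assms by (simp add: permutes_not_in bij_is_surj surj_f_inv_f)
qed

lemma linked_conj_by_iff:
  assumes "bij \<pi>"
  shows "(\<pi> x, \<pi> y) \<in> linked (conj_by \<pi> ` P) \<longleftrightarrow> (x, y) \<in> linked P"
proof
  have inv: "Hilbert_Choice.inv \<pi> (\<pi> z) = z" for z
    using assms by (simp add: bij_is_inj)
  let ?i = "Hilbert_Choice.inv \<pi>"
  show "(\<pi> x, \<pi> y) \<in> linked (conj_by \<pi> ` P)" if "(x, y) \<in> linked P"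
    using that
  proof (induction rule: linked_induct)
    case (step p z)
    have "(\<pi> z, \<pi> (p z)) \<in> linked (conj_by \<pi> ` P)"
      using linked_step[of "conj_by \<pi> p" "conj_by \<pi> ` P" "\<pi> z"] step(1) by (simp add: inv)
    then show ?case using linked_trans[OF step(2)] by blast
  next
    case (unstep p z)
    have "(\<pi> z, \<pi> (p z)) \<in> linked (conj_by \<pi> ` P)"
      using linked_step[of "conj_by \<pi> p" "conj_by \<pi> ` P" "\<pi> z"] unstep(1) by (simp add: inv)
    then show ?case using linked_trans[OF unstep(2) linked_sym] by blast
  qed simp
  assume "(\<pi> x, \<pi> y) \<in> linked (conj_by \<pi> ` P)"
  then have "(x, ?i (\<pi> y)) \<in> linked P"
  proof (induction rule: linked_induct)
    case (step q z)
    then obtain p where p: "p \<in> P" "q = conj_by \<pi> p" by blast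
    show ?case using linked_trans[OF step(2) linked_step[OF p(1)]] by (simp add: p inv)
  next
    case (unstep q z)
    then obtain p where p: "p \<in> P" "q = conj_by \<pi> p" by blast
    have "(x, p (?i z)) \<in> linked P" using unstep(2) by (simp add: p inv)
    then show ?case using linked_trans[OF _ linked_sym[OF linked_step[OF p(1)]]] by blast
  qed (simp add: inv)
  then show "(x, y) \<in> linked P" by (simp add: inv)
qed

lemma blocks_conj_by:
  assumes "bij \<pi>"
  shows "blocks (\<pi> ` A) (conj_by \<pi> ` P) = image \<pi> ` blocks A P"
proof -
  have "linked (conj_by \<pi> ` P) `` {\<pi> x} = \<pi> ` (linked P `` {x})" for x
  proof (rule Set.set_eqI)
    fix w
    obtain v where "w = \<pi> v" using assms by (metis bij_pointE)
    then show "w \<in> linked (conj_by \<pi> ` P) `` {\<pi> x} \<longleftrightarrow> w \<in> \<pi> ` (linked P `` {x})"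
      using assms by (auto simp: linked_conj_by_iff inj_image_mem_iff bij_is_inj)
  qed
  then show ?thesis by (simp add: blocks_def image_image)
qed

lemma card_blocks_conj_by:
  assumes "bij \<pi>"
  shows "card (blocks (\<pi> ` A) {conj_by \<pi> p}) = card (blocks A {p})"
proof -
  have "inj_on (image \<pi>) (blocks A {p})"
    by (rule inj_on_image[OF inj_on_subset[OF bij_is_inj[OF assms] subset_UNIV]])
  then show ?thesis using blocks_conj_by[OF assms, of A "{p}"] by (simp add: card_image)
qed

lemma transitive_pairs_conj_by:
  assumes "(p, q) \<in> transitive_pairs A" "bij \<pi>"
  shows "(conj_by \<pi> p, conj_by \<pi> q) \<in> transitive_pairs (\<pi> ` A)"
  using assms conj_by_permutes[OF assms(2), of _ A] linked_conj_by_iff[OF assms(2), of _ _ "{p, q}"]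
  by (auto simp: transitive_pairs_def)

text \<open>Conjugation is by permutations of the whole type, as otherwise inverses would have to be taken
relative to a set; hence a bijection between two finite sets is extended to one of the whole type.\<close>

lemma ex_bij_image:
  fixes A B :: "'a set"
  assumes "finite A" "finite B" "card A = card B"
  shows "\<exists>\<pi>. bij \<pi> \<and> \<pi> ` A = B"
proof -
  obtain f where f: "bij_betw f A B" using assms finite_same_card_bij by blast
  have "card (B - A) = card (A - B)"
    using assms by (metis card_Diff_subset_Int finite_Int inf_commute)
  then obtain g where g: "bij_betw g (B - A) (A - B)"
    using assms finite_same_card_bij finite_Diff by metis
  \<comment> \<open>to stay injective, the points of \<open>B - A\<close> give way to the points of \<open>A - B\<close>, which \<open>f\<close> does not hit\<close>
  let ?h = "\<lambda>z. if z \<in> A then f z else if z \<in> B - A then g z else z"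
  have "bij_betw ?h A B" using f by (rule bij_betw_cong[THEN iffD1, rotated]) simp
  moreover have "bij_betw ?h (B - A) (A - B)" using g by (rule bij_betw_cong[THEN iffD1, rotated]) simp
  ultimately have "bij_betw ?h (A \<union> (B - A)) (B \<union> (A - B))" by (rule bij_betw_combine) blast
  moreover have "A \<union> (B - A) = A \<union> B" "B \<union> (A - B) = A \<union> B" by auto
  ultimately have "?h permutes (A \<union> B)" by (intro bij_imp_permutes) auto
  then have "bij ?h" by (rule permutes_bij)
  moreover have "?h ` A = B" using \<open>bij_betw ?h A B\<close> by (simp add: bij_betw_def)
  ultimately show ?thesis by blast
qed

context multiplicative_weight
begin

lemma conj_by_inv:
  assumes "bij \<pi>"
  shows "conj_by (Hilbert_Choice.inv \<pi>) (conj_by \<pi> p) = p" "conj_by \<pi> (conj_by (Hilbert_Choice.inv \<pi>) p) = p"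
  using assms by (auto simp: fun_eq_iff inv_inv_eq bij_is_inj bij_is_surj surj_f_inv_f)

lemma sum_pairs_image:
  assumes "bij \<pi>" "finite A"
    and "\<And>p q. (p, q) \<in> X \<Longrightarrow> p permutes A \<and> q permutes A"
    and "\<And>p q. (p, q) \<in> X \<Longrightarrow> (conj_by \<pi> p, conj_by \<pi> q) \<in> Y"
    and "\<And>p q. (p, q) \<in> Y \<Longrightarrow> (conj_by (Hilbert_Choice.inv \<pi>) p, conj_by (Hilbert_Choice.inv \<pi>) q) \<in> X"
  shows "(\<Sum>(p, q)\<in>X. F A p q) = (\<Sum>(p, q)\<in>Y. F (\<pi> ` A) p q)"
  by (rule sum.reindex_bij_witness[where
        i = "\<lambda>(p, q). (conj_by (Hilbert_Choice.inv \<pi>) p, conj_by (Hilbert_Choice.inv \<pi>) q)"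
        and j = "\<lambda>(p, q). (conj_by \<pi> p, conj_by \<pi> q)"])
    (use assms(3-5) conj[OF assms(1,2)] in \<open>auto simp only: prod.case split: prod.split simp: conj_by_inv[OF assms(1)]\<close>)

lemma pair_sum_cong_card:
  assumes "finite A" "finite B" "card A = card B"
  shows "pair_sum F A = pair_sum F B" "transitive_pair_sum F A = transitive_pair_sum F B"
proof -
  obtain \<pi> where \<pi>: "bij \<pi>" "\<pi> ` A = B" using ex_bij_image[OF assms] by blast
  let ?i = "Hilbert_Choice.inv \<pi>"
  have i: "bij ?i" "?i ` B = A"
    using \<pi> by (auto simp: bij_imp_bij_inv image_image bij_is_inj)
  note conj_perm = conj_by_permutes[OF \<pi>(1), of _ A, unfolded \<pi>(2)]
    conj_by_permutes[OF i(1), of _ B, unfolded i(2)]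
  show "pair_sum F A = pair_sum F B"
    unfolding pair_sum_def \<pi>(2)[symmetric]
    by (rule sum_pairs_image[OF \<pi>(1) assms(1)]) (use conj_perm \<pi>(2) in auto)
  show "transitive_pair_sum F A = transitive_pair_sum F B"
    unfolding transitive_pair_sum_def \<pi>(2)[symmetric]
  proof (rule sum_pairs_image[OF \<pi>(1) assms(1)])
    fix p q
    show "(p, q) \<in> transitive_pairs A \<Longrightarrow> p permutes A \<and> q permutes A"
      by (auto simp: transitive_pairs_def)
    show "(p, q) \<in> transitive_pairs A \<Longrightarrow> (conj_by \<pi> p, conj_by \<pi> q) \<in> transitive_pairs (\<pi> ` A)"
      using transitive_pairs_conj_by \<pi>(1) by blast
    show "(p, q) \<in> transitive_pairs (\<pi> ` A) \<Longrightarrow> (conj_by ?i p, conj_by ?i q) \<in> transitive_pairs A"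
      using transitive_pairs_conj_by[OF _ i(1), of p q B] \<pi>(2) i(2) by simp
  qed
qed

end

lemma sum_Pow_card:
  fixes g :: "nat \<Rightarrow> 'r::comm_semiring_1"
  assumes "finite A"
  shows "(\<Sum>B\<in>Pow A. g (card B)) = (\<Sum>k\<le>card A. of_nat (card A choose k) * g k)"
proof -
  have "card ` Pow A \<subseteq> {..card A}" using assms by (auto intro: card_mono)
  then have "(\<Sum>B\<in>Pow A. g (card B)) = (\<Sum>k\<le>card A. \<Sum>B\<in>{B\<in>Pow A. card B = k}. g (card B))"
    using assms by (intro sum.group[symmetric]) auto
  also have "\<dots> = (\<Sum>k\<le>card A. of_nat (card A choose k) * g k)"
    using assms by (intro sum.cong refl) (simp add: n_subsets)
  finally show ?thesis .
qed

text \<open>The exponential formula in differential form. For the exponential generating functions \<open>Z\<close> of all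
pairs and \<open>L\<close> of the transitive ones it says \<open>Z' = L' Z\<close>.\<close>

lemma (in multiplicative_weight) pair_sum_Suc:
  fixes S :: "nat \<Rightarrow> 'a set"
  assumes S: "\<And>n. finite (S n)" "\<And>n. card (S n) = n"
  shows "pair_sum F (S (Suc d)) =
    (\<Sum>k\<le>d. of_nat (d choose k) * (transitive_pair_sum F (S (Suc k)) * pair_sum F (S (d - k))))"
proof -
  obtain x A where A: "S (Suc d) = insert x A" "x \<notin> A" "finite A" "card A = d"
    using S(1)[of "Suc d"] S(2)[of "Suc d"] by (metis card_Suc_eq finite_insert)
  have *: "transitive_pair_sum F (insert x B) * pair_sum F (A - B)
      = transitive_pair_sum F (S (Suc (card B))) * pair_sum F (S (d - card B))" if "B \<in> Pow A" for B
  proof -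
    have "finite B" "x \<notin> B" "card (A - B) = d - card B"
      using that A finite_subset[of B A] by (auto simp: card_Diff_subset)
    then show ?thesis
      using S A by (intro arg_cong2[where f = "(*)"] pair_sum_cong_card) auto
  qed
  show ?thesis
    unfolding A(1) pair_sum_decomposition[OF A(3,2)]
    using sum_Pow_card[OF A(3), of "\<lambda>k. transitive_pair_sum F (S (Suc k)) * pair_sum F (S (d - k))"]
      sum.cong[OF refl *, of "Pow A" "\<lambda>x. x"] A(4) by simp
qed

section \<open>Permutations all of whose cycles have the same length\<close>

lemma Union_blocks:
  assumes "\<And>p. p \<in> P \<Longrightarrow> p permutes A"
  shows "\<Union>(blocks A P) = A"
proof (intro equalityI subsetI)
  fix y assume "y \<in> \<Union>(blocks A P)"
  then obtain x where "x \<in> A" "(x, y) \<in> linked P" by (auto simp: blocks_def)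
  then show "y \<in> A" using linked_permutes[of x y P A] assms by simp
next
  fix y assume "y \<in> A"
  then show "y \<in> \<Union>(blocks A P)" using linked_refl[of y P] unfolding blocks_def by blast
qed

lemma blocks_disjoint:
  assumes "c \<in> blocks A P" "c' \<in> blocks A P" "c \<noteq> c'"
  shows "c \<inter> c' = {}"
proof (rule ccontr)
  assume "c \<inter> c' \<noteq> {}"
  then obtain z where z: "z \<in> c" "z \<in> c'" by blast
  obtain x y where xy: "c = linked P `` {x}" "c' = linked P `` {y}"
    using assms by (auto simp: blocks_def)
  then have "linked P `` {x} = linked P `` {z}" "linked P `` {y} = linked P `` {z}"
    using z by (simp_all add: linked_class_eq)
  then show False using assms(3) xy by simp
qed

lemma card_regular:
  assumes "finite A" "q permutes A" "\<And>c. c \<in> blocks A {q} \<Longrightarrow> card c = a"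
  shows "card A = a * card (blocks A {q})"
proof -
  have "\<Union>(blocks A {q}) = A" using assms(2) by (intro Union_blocks) simp
  moreover have "a * card (blocks A {q}) = card (\<Union>(blocks A {q}))"
    using assms(1,3) calculation blocks_disjoint[of _ A "{q}"] by (intro card_partition) auto
  ultimately show ?thesis by simp
qed

lemma transitive_iff_card_blocks:
  assumes "finite A" "A \<noteq> {}"
  shows "(\<forall>x\<in>A. \<forall>y\<in>A. (x, y) \<in> linked P) \<longleftrightarrow> card (blocks A P) = 1"
proof
  assume *: "\<forall>x\<in>A. \<forall>y\<in>A. (x, y) \<in> linked P"
  obtain x where x: "x \<in> A" using assms by blast
  then have "linked P `` {y} = linked P `` {x}" if "y \<in> A" for y
    using * that unfolding linked_class_eq by blast
  then have "blocks A P = (\<lambda>_. linked P `` {x}) ` A" unfolding blocks_def by (rule image_cong[OF refl])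
  then have "blocks A P = {linked P `` {x}}" using x by (auto simp: image_constant_conv)
  then show "card (blocks A P) = 1" by simp
next
  assume "card (blocks A P) = 1"
  then obtain c where "blocks A P = {c}" by (auto simp: card_Suc_eq)
  then have "linked P `` {x} = c" if "x \<in> A" for x using that by (auto simp: blocks_def)
  then show "\<forall>x\<in>A. \<forall>y\<in>A. (x, y) \<in> linked P" unfolding linked_class_eq[symmetric] by simp
qed

definition regular_perms :: "nat \<Rightarrow> 'a set \<Rightarrow> ('a \<Rightarrow> 'a) set" where
  "regular_perms a A = {q. q permutes A \<and> (\<forall>c\<in>blocks A {q}. card c = a)}"

lemma regular_disjoint_comp:
  assumes "q permutes B" "q' permutes D" "B \<inter> D = {}"
  shows "(\<forall>c\<in>blocks (B \<union> D) {q \<circ> q'}. card c = a)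
    \<longleftrightarrow> (\<forall>c\<in>blocks B {q}. card c = a) \<and> (\<forall>c\<in>blocks D {q'}. card c = a)"
  by (auto simp: blocks_disjoint_comp(1)[OF assms])

lemma regular_conj_by:
  assumes "bij \<pi>"
  shows "(\<forall>c\<in>blocks (\<pi> ` A) {conj_by \<pi> q}. card c = a) \<longleftrightarrow> (\<forall>c\<in>blocks A {q}. card c = a)"
proof -
  have "card (\<pi> ` c) = card c" for c
    using assms by (intro card_image inj_on_subset[OF bij_is_inj]) auto
  then show ?thesis using blocks_conj_by[OF assms, of A "{q}"] by simp
qed

text \<open>Permutations with all cycles of length \<open>a\<close> are counted by the exponential formula once more: in
pairs whose first component is the identity, transitivity means that the second component is a
single cycle.\<close>

definition regular_weight :: "nat \<Rightarrow> 'a set \<Rightarrow> ('a \<Rightarrow> 'a) \<Rightarrow> ('a \<Rightarrow> 'a) \<Rightarrow> rat" where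
  "regular_weight a A p q = (if p = id \<and> (\<forall>c\<in>blocks A {q}. card c = a) then 1 else 0)"

lemma multiplicative_regular_weight: "multiplicative_weight (regular_weight a)"
proof
  fix B D :: "'a set" and p q p' q' :: "'a \<Rightarrow> 'a"
  assume *: "finite B" "finite D" "B \<inter> D = {}" "p permutes B" "q permutes B" "p' permutes D" "q' permutes D"
  have "p \<circ> p' = id \<longleftrightarrow> p = id \<and> p' = id"
  proof
    assume id: "p \<circ> p' = id"
    note s = disjoint_permutes_simps[OF *(4,6,3)]
    have "p z = z" for z
      using s(1)[of z] permutes_not_in[OF *(4), of z] unfolding id by (cases "z \<in> B") simp_all
    moreover have "p' z = z" for z
      using s(2)[of z] permutes_not_in[OF *(6), of z] unfolding id by (cases "z \<in> D") simp_all
    ultimately show "p = id \<and> p' = id" by auto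
  qed simp
  then show "regular_weight a (B \<union> D) (p \<circ> p') (q \<circ> q') = regular_weight a B p q * regular_weight a D p' q'"
    unfolding regular_weight_def regular_disjoint_comp[OF *(5,7,3)] by simp
next
  fix \<pi> :: "'a \<Rightarrow> 'a" and B :: "'a set" and p q :: "'a \<Rightarrow> 'a"
  assume *: "bij \<pi>" "finite B" "p permutes B" "q permutes B"
  have "conj_by \<pi> p = id \<longleftrightarrow> p = id"
  proof
    assume id: "conj_by \<pi> p = id"
    have "\<pi> (p z) = \<pi> z" for z
      using fun_cong[OF id, of "\<pi> z"] *(1) by (simp add: bij_is_inj)
    then show "p = id" using *(1) by (auto simp: fun_eq_iff bij_is_inj inj_eq)
  qed (use *(1) in \<open>simp add: fun_eq_iff bij_is_surj surj_f_inv_f\<close>)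
  then show "regular_weight a (\<pi> ` B) (conj_by \<pi> p) (conj_by \<pi> q) = regular_weight a B p q"
    unfolding regular_weight_def regular_conj_by[OF *(1)] by simp
qed

lemma pair_sum_regular_weight:
  assumes "finite A"
  shows "pair_sum (regular_weight a) A = of_nat (card (regular_perms a A))"
proof -
  have "pair_sum (regular_weight a) A
      = (\<Sum>(p, q)\<in>{id} \<times> {q. q permutes A}. regular_weight a A p q)"
    unfolding pair_sum_def
    by (rule sum.mono_neutral_right)
      (use assms in \<open>auto simp: finite_permutations regular_weight_def split: if_splits\<close>)
  also have "\<dots> = (\<Sum>q\<in>{q. q permutes A}. regular_weight a A id q)"
    by (simp flip: sum.cartesian_product)
  also have "\<dots> = of_nat (card (regular_perms a A))"
    using finite_permutations[OF assms]
    by (simp add: regular_weight_def regular_perms_def sum.If_cases Int_def)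
  finally show ?thesis .
qed

lemma transitive_pair_sum_regular_weight:
  fixes A :: "'a set"
  assumes "finite A" "A \<noteq> {}"
  shows "transitive_pair_sum (regular_weight a) A = (if card A = a then fact (card A - 1) else 0)"
proof -
  let ?w = "\<lambda>q. if card (blocks A {q}) = 1 then 1 else 0 :: rat"
  have w: "(\<Sum>(p, q)\<in>transitive_pairs A. regular_weight a A p q)
      = (\<Sum>(p :: 'a \<Rightarrow> 'a, q)\<in>{id} \<times> {q. q permutes A}. if card A = a then ?w q else 0)"
  proof (rule sum.mono_neutral_cong)
    show "finite ({id} \<times> {q. q permutes A})" using assms by (simp add: finite_permutations)
    have trans: "(id, q) \<in> transitive_pairs A \<longleftrightarrow> card (blocks A {q}) = 1" if "q permutes A" for q
      unfolding transitive_pairs_def using that transitive_iff_card_blocks[OF assms, of "{q}"]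
      by (simp add: linked_insert_id)
    {
      fix u assume "u \<in> transitive_pairs A - {id} \<times> {q. q permutes A}"
      then show "(case u of (p, q) \<Rightarrow> regular_weight a A p q) = 0"
        by (auto simp: transitive_pairs_def regular_weight_def split: if_splits)
    next
      fix u assume "u \<in> {id} \<times> {q. q permutes A} - transitive_pairs A"
      then show "(case u of (p, q) \<Rightarrow> if card A = a then ?w q else 0) = 0"
        using trans by auto
    next
      fix u assume "u \<in> transitive_pairs A \<inter> {id} \<times> {q. q permutes A}"
      then obtain q where q: "u = (id, q)" "q permutes A" "card (blocks A {q}) = 1"
        using trans by auto
      then obtain c where "blocks A {q} = {c}" by (auto simp: card_Suc_eq)
      moreover from this have "c = A" using Union_blocks[of "{q}" A] q(2) by simp
      ultimately show "(case u of (p, q) \<Rightarrow> regular_weight a A p q)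
          = (case u of (p, q) \<Rightarrow> if card A = a then ?w q else 0)"
        using q by (simp add: regular_weight_def)
    }
  qed (rule finite_transitive_pairs[OF assms(1)])
  also have "\<dots> = (if card A = a then (\<Sum>q | q permutes A. ?w q) else 0)"
    by (simp flip: sum.cartesian_product)
  finally show ?thesis
    unfolding transitive_pair_sum_def sum_cyclic_permutations[OF assms] .
qed

text \<open>With \<open>N d\<close> for the number of these permutations, \<open>N d / d!\<close> is the coefficient of \<open>z ^ d\<close> in
\<open>exp (z ^ a / a)\<close>. The cycle of a chosen point contributes \<open>(a - 1)!\<close> times a binomial
coefficient; after division by the factorial, one over the number of points is left.\<close>

lemma card_regular_perms_rec:
  fixes S :: "nat \<Rightarrow> 'a set"
  assumes S: "\<And>n. finite (S n)" "\<And>n. card (S n) = n" and a: "0 < a"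
  shows "rat_of_nat (card (regular_perms a (S (Suc d)))) / fact (Suc d)
    = (if a \<le> Suc d then (1 / of_nat (Suc d)) * (of_nat (card (regular_perms a (S (Suc d - a)))) / fact (Suc d - a)) else 0)"
proof -
  interpret multiplicative_weight "regular_weight a :: 'a set \<Rightarrow> _" by (rule multiplicative_regular_weight)
  let ?N = "\<lambda>d. rat_of_nat (card (regular_perms a (S d)))"
  have ne: "S (Suc k) \<noteq> {}" for k using S(2)[of "Suc k"] by auto
  have tr: "transitive_pair_sum (regular_weight a) (S (Suc k)) = (if Suc k = a then fact k else 0)" for k
    using transitive_pair_sum_regular_weight[OF S(1) ne, of a k] S(2)[of "Suc k"] by auto
  have "?N (Suc d) = (\<Sum>k\<le>d. of_nat (d choose k) * ((if Suc k = a then fact k else 0) * ?N (d - k)))"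
    using pair_sum_Suc[OF S, of d]
    by (simp add: pair_sum_regular_weight S tr)
  also have "\<dots> = (\<Sum>k\<le>d. if k = a - 1 then of_nat (d choose k) * (fact k * ?N (d - k)) else 0)"
    using a by (intro sum.cong refl) auto
  also have "\<dots> = (if a \<le> Suc d then of_nat (d choose (a - 1)) * (fact (a - 1) * ?N (Suc d - a)) else 0)"
    using a by (auto simp: Suc_diff_le)
  finally have N: "?N (Suc d) = \<dots>" .
  show ?thesis
  proof (cases "a \<le> Suc d")
    case True
    then have le: "a - 1 \<le> d" and eq: "d - (a - 1) = Suc d - a" using a by auto
    show ?thesis
      unfolding N using True binomial_fact[OF le, where 'a = rat] eq by simp
  qed (simp add: N)
qed

section \<open>From labelled hypermaps to transitive pairs\<close>

lemma perm_cycles_eq_blocks: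
  "\<sigma> permutes {1..d} \<Longrightarrow> perm_cycles d \<sigma> = blocks {1..d} {\<sigma>}"
  by (simp add: perm_cycles_def blocks_def linked_singleton_orbit)

text \<open>The third permutation is the inverse of the product of the other two, so it adds nothing to the
generated group, and the orbits of the group are the joint orbits of \<open>\<sigma>0\<close> and \<open>\<sigma>1\<close>.\<close>

lemma generate_transitive_iff:
  assumes s: "\<sigma>0 permutes {1..d}" "\<sigma>1 permutes {1..d}" "\<sigma>2 permutes {1..d}" "\<sigma>0 \<circ> \<sigma>1 \<circ> \<sigma>2 = id"
  shows "(\<exists>\<pi>\<in>generate (sym_group d) {\<sigma>0, \<sigma>1, \<sigma>2}. \<pi> x = y) \<longleftrightarrow> (x, y) \<in> linked {\<sigma>0, \<sigma>1}"
proof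
  let ?G = "generate (sym_group d) {\<sigma>0, \<sigma>1, \<sigma>2}"
  have carr: "p permutes {1..d}" if "p \<in> {\<sigma>0, \<sigma>1, \<sigma>2}" for p using that s by auto
  have inv_eq: "m_inv (sym_group d) p = Hilbert_Choice.inv p" if "p \<in> {\<sigma>0, \<sigma>1, \<sigma>2}" for p
    using sym_group_inv_equality[unfolded sym_group_carrier, OF carr[OF that]] .
  have gen: "(z, p z) \<in> linked {\<sigma>0, \<sigma>1}" if "p \<in> {\<sigma>0, \<sigma>1, \<sigma>2}" for p z
  proof -
    have l: "(z, \<sigma>0 z) \<in> linked {\<sigma>0, \<sigma>1}" "(z, \<sigma>1 z) \<in> linked {\<sigma>0, \<sigma>1}" for z
      by (simp_all add: linked_step)
    have "(\<sigma>2 z, \<sigma>0 (\<sigma>1 (\<sigma>2 z))) \<in> linked {\<sigma>0, \<sigma>1}"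
      using l(2)[of "\<sigma>2 z"] l(1) by (rule linked_trans)
    moreover have "\<sigma>0 (\<sigma>1 (\<sigma>2 z)) = z" using fun_cong[OF s(4), of z] by simp
    ultimately have "(z, \<sigma>2 z) \<in> linked {\<sigma>0, \<sigma>1}" by (simp add: linked_sym)
    then show ?thesis using that l by auto
  qed
  {
    assume "\<exists>\<pi>\<in>?G. \<pi> x = y"
    then obtain \<pi> where \<pi>: "\<pi> \<in> ?G" "\<pi> x = y" by blast
    have "(z, \<pi> z) \<in> linked {\<sigma>0, \<sigma>1}" for z
      using \<pi>(1)
    proof (induction arbitrary: z rule: generate.induct)
      case one
      then show ?case by (simp add: sym_group_one)
    next
      case (incl h)
      then show ?case by (rule gen)
    next
      case (inv h)
      have "h (Hilbert_Choice.inv h z) = z"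
        using permutes_inverses(1)[OF carr[OF inv]] .
      then show ?case
        using linked_sym[OF gen[OF inv, of "Hilbert_Choice.inv h z"]] by (simp add: inv_eq[OF inv])
    next
      case (eng h1 h2)
      show ?case using linked_trans[OF eng(4)[of z] eng(3)[of "h2 z"]] by (simp add: sym_group_mult)
    qed
    then show "(x, y) \<in> linked {\<sigma>0, \<sigma>1}" using \<pi>(2) by blast
  next
    assume "(x, y) \<in> linked {\<sigma>0, \<sigma>1}"
    then show "\<exists>\<pi>\<in>?G. \<pi> x = y"
    proof (induction rule: linked_induct)
      case refl
      show ?case
        using generate.one[of "sym_group d" "{\<sigma>0, \<sigma>1, \<sigma>2}"] by (intro bexI[of _ id]) (simp_all add: sym_group_one)
    next
      case (step p z)
      then obtain \<pi> where \<pi>: "\<pi> \<in> ?G" "\<pi> x = z" by blast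
      have "p \<in> ?G" using step(1) by (intro generate.incl) auto
      then have "p \<circ> \<pi> \<in> ?G" using generate.eng[OF _ \<pi>(1), of p] by (simp add: sym_group_mult)
      then show ?case using \<pi>(2) by (intro bexI[of _ "p \<circ> \<pi>"]) auto
    next
      case (unstep p z)
      then obtain \<pi> where \<pi>: "\<pi> \<in> ?G" "\<pi> x = p z" by blast
      have p: "p \<in> {\<sigma>0, \<sigma>1, \<sigma>2}" using unstep(1) by auto
      have "Hilbert_Choice.inv p \<in> ?G" using generate.inv[OF p, of "sym_group d"] inv_eq[OF p] by simp
      then have "Hilbert_Choice.inv p \<circ> \<pi> \<in> ?G" using generate.eng[OF _ \<pi>(1), of "Hilbert_Choice.inv p"] by (simp add: sym_group_mult)
      moreover have "(Hilbert_Choice.inv p \<circ> \<pi>) x = z"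
        using \<pi>(2) permutes_inverses(2)[OF carr[OF p]] by simp
      ultimately show ?case by blast
    qed
  }
qed

text \<open>What remains of a hypermap of genus \<open>g\<close> with \<open>n\<close> points over infinity when the redundant third
permutation and the labelling of its cycles are dropped.\<close>

definition hypermap_pairs :: "nat \<Rightarrow> nat \<Rightarrow> nat \<Rightarrow> nat \<Rightarrow> ((nat \<Rightarrow> nat) \<times> (nat \<Rightarrow> nat)) set" where
  "hypermap_pairs a g n d = {(p, q) \<in> transitive_pairs {1..d}. q \<in> regular_perms a {1..d} \<and>
     card (blocks {1..d} {Hilbert_Choice.inv (p \<circ> q)}) = n \<and>
     (of_nat (card (blocks {1..d} {p})) :: rat)
       = 2 - 2 * of_nat g - of_nat n + (of_nat a - 1) * (of_nat d / of_nat a)}"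

lemma comp_eq_id_iff_inv:
  assumes "r permutes A"
  shows "r \<circ> s = id \<longleftrightarrow> s = Hilbert_Choice.inv r"
proof
  assume "r \<circ> s = id"
  then have "Hilbert_Choice.inv r \<circ> (r \<circ> s) = Hilbert_Choice.inv r" by simp
  then show "s = Hilbert_Choice.inv r"
    using permutes_inv_o(2)[OF assms] by (simp add: comp_assoc[symmetric])
qed (use permutes_inv_o(1)[OF assms] in simp)

lemma hypermaps_iff:
  "(\<sigma>0, \<sigma>1, \<sigma>2, cs) \<in> hypermaps a g bs \<longleftrightarrow>
     (\<sigma>0, \<sigma>1) \<in> hypermap_pairs a g (length bs) (sum_list bs) \<and> \<sigma>2 = Hilbert_Choice.inv (\<sigma>0 \<circ> \<sigma>1) \<and>
     distinct cs \<and> set cs = blocks {1..sum_list bs} {\<sigma>2} \<and> map card cs = bs"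
proof -
  define d where "d = sum_list bs"
  have *: "?thesis" if s: "\<sigma>0 permutes {1..d}" "\<sigma>1 permutes {1..d}" "\<sigma>2 = Hilbert_Choice.inv (\<sigma>0 \<circ> \<sigma>1)"
  proof -
    have p: "\<sigma>0 \<circ> \<sigma>1 permutes {1..d}" using s by (simp add: permutes_compose)
    then have s2: "\<sigma>2 permutes {1..d}" using s by (simp add: permutes_inv)
    have "\<sigma>0 \<circ> \<sigma>1 \<circ> \<sigma>2 = id" using comp_eq_id_iff_inv[OF p] s(3) by blast
    note gen = generate_transitive_iff[OF s(1,2) s2 this]
    have len: "card (blocks {1..d} {\<sigma>2}) = length bs"
      if "distinct cs" "set cs = blocks {1..d} {\<sigma>2}" "map card cs = bs"
      using that distinct_card[of cs] by (metis length_map)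
    show ?thesis
      unfolding hypermaps_def Let_def d_def[symmetric] mem_Collect_eq case_prod_conv gen
        perm_cycles_eq_blocks[OF s(1)] perm_cycles_eq_blocks[OF s(2)] perm_cycles_eq_blocks[OF s2]
        hypermap_pairs_def transitive_pairs_def regular_perms_def
      using s s2 \<open>\<sigma>0 \<circ> \<sigma>1 \<circ> \<sigma>2 = id\<close> len by blast
  qed
  show ?thesis
  proof (cases "\<sigma>0 permutes {1..d} \<and> \<sigma>1 permutes {1..d} \<and> \<sigma>2 = Hilbert_Choice.inv (\<sigma>0 \<circ> \<sigma>1)")
    case False
    then have "(\<sigma>0, \<sigma>1) \<notin> hypermap_pairs a g (length bs) d \<or> \<sigma>2 \<noteq> Hilbert_Choice.inv (\<sigma>0 \<circ> \<sigma>1)"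
      by (auto simp: hypermap_pairs_def transitive_pairs_def)
    moreover have "(\<sigma>0, \<sigma>1, \<sigma>2, cs) \<notin> hypermaps a g bs"
      using False comp_eq_id_iff_inv[of "\<sigma>0 \<circ> \<sigma>1" "{1..d}" \<sigma>2]
      by (auto simp: hypermaps_def Let_def d_def[symmetric] permutes_compose)
    ultimately show ?thesis by (auto simp: d_def)
  qed (use * in blast)
qed

lemma finite_hypermap_pairs: "finite (hypermap_pairs a g n d)"
  by (rule finite_subset[OF _ finite_transitive_pairs[of "{1..d}"]]) (auto simp: hypermap_pairs_def)

definition labellings :: "nat \<Rightarrow> (nat \<Rightarrow> nat) \<times> (nat \<Rightarrow> nat) \<Rightarrow> nat set list set" where
  "labellings d = (\<lambda>(p, q). permutations_of_set (blocks {1..d} {Hilbert_Choice.inv (p \<circ> q)}))"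

lemma hypermaps_eq_image:
  "hypermaps a g bs = (\<lambda>((p, q), cs). (p, q, Hilbert_Choice.inv (p \<circ> q), cs)) `
     {(u, cs) \<in> Sigma (hypermap_pairs a g (length bs) (sum_list bs)) (labellings (sum_list bs)). map card cs = bs}"
  (is "_ = ?f ` ?X")
proof (intro equalityI subsetI)
  note defs = hypermaps_iff labellings_def permutations_of_set_def mem_Collect_eq prod.case mem_Sigma_iff
  fix t assume t: "t \<in> hypermaps a g bs"
  obtain p q r cs where e: "t = (p, q, r, cs)" by (cases t)
  have "((p, q), cs) \<in> ?X" "r = Hilbert_Choice.inv (p \<circ> q)"
    using t unfolding e defs by blast+
  then show "t \<in> ?f ` ?X" by (intro image_eqI[of _ _ "((p, q), cs)"]) (simp_all only: e prod.case)
next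
  note defs = hypermaps_iff labellings_def permutations_of_set_def mem_Collect_eq prod.case mem_Sigma_iff
  fix t assume "t \<in> ?f ` ?X"
  then obtain p q cs where "((p, q), cs) \<in> ?X" "t = (p, q, Hilbert_Choice.inv (p \<circ> q), cs)"
    by (auto simp only: prod.case)
  then show "t \<in> hypermaps a g bs"
    unfolding defs by (simp only: hypermaps_iff simp_thms)
qed

lemma finite_hypermaps: "finite (hypermaps a g bs)"
proof -
  have "finite (Sigma (hypermap_pairs a g (length bs) (sum_list bs)) (labellings (sum_list bs)))"
    by (intro finite_SigmaI finite_hypermap_pairs) (simp add: labellings_def split: prod.split)
  then have "finite {(u, cs) \<in> Sigma (hypermap_pairs a g (length bs) (sum_list bs)) (labellings (sum_list bs)).
      map card cs = bs}"
    by (rule finite_subset[rotated]) blast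
  then show ?thesis unfolding hypermaps_eq_image by (rule finite_imageI)
qed

text \<open>The list \<open>bs\<close> of ramification orders is determined by the labelled cycles, so summing over it
removes it as a constraint; each pair then occurs once for every order of the \<open>n\<close> cycles.\<close>

lemma sum_card_hypermaps:
  "(\<Sum>bs\<in>{bs. length bs = n \<and> (\<forall>b\<in>set bs. b \<ge> 1) \<and> sum_list bs = d}. card (hypermaps a g bs))
     = fact n * card (hypermap_pairs a g n d)"
proof -
  let ?B = "{bs :: nat list. length bs = n \<and> (\<forall>b\<in>set bs. b \<ge> 1) \<and> sum_list bs = d}"
  let ?f = "\<lambda>((p, q), cs). (p, q, Hilbert_Choice.inv (p \<circ> q), cs)"
  let ?S = "Sigma (hypermap_pairs a g n d) (labellings d)"
  have finB: "finite ?B"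
    by (rule finite_subset[OF _ finite_lists_length_eq[of "{..d}" n]]) (auto simp: member_le_sum_list)
  have shape: "map card cs \<in> ?B" if "(u, cs) \<in> ?S" for u cs
  proof -
    obtain p q where u: "u = (p, q)" by (cases u)
    let ?r = "Hilbert_Choice.inv (p \<circ> q)"
    have r: "?r permutes {1..d}" and n: "card (blocks {1..d} {?r}) = n"
      using that by (auto simp: u hypermap_pairs_def transitive_pairs_def permutes_compose permutes_inv)
    have cs: "set cs = blocks {1..d} {?r}" "distinct cs"
      using that by (auto simp: u labellings_def permutations_of_set_def)
    have U: "\<Union>(blocks {1..d} {?r}) = {1..d}" using r by (intro Union_blocks) simp
    have fin: "finite c" if "c \<in> blocks {1..d} {?r}" for c
      using that U by (metis Union_upper finite_atLeastAtMost finite_subset)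
    have pos: "card c \<ge> 1" if "c \<in> blocks {1..d} {?r}" for c
    proof -
      have "c \<noteq> {}" using that linked_refl by (fastforce simp: blocks_def)
      then show ?thesis using fin[OF that] by (simp add: Suc_le_eq card_gt_0_iff)
    qed
    have "sum_list (map card cs) = sum card (blocks {1..d} {?r})"
      using cs by (simp add: sum_list_distinct_conv_sum_set)
    also have "\<dots> = card (\<Union>(blocks {1..d} {?r}))"
      using fin blocks_disjoint[of _ "{1..d}" "{?r}"]
      by (intro card_Union_disjoint[symmetric]) (auto simp: pairwise_def disjnt_def)
    finally have "sum_list (map card cs) = d" using U by simp
    moreover have "length cs = n" using cs n distinct_card by metis
    ultimately show ?thesis using pos cs by auto
  qed
  have "(\<Sum>bs\<in>?B. card (hypermaps a g bs)) = card (\<Union>bs\<in>?B. hypermaps a g bs)"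
    by (rule card_UN_disjoint[symmetric, OF finB])
      (auto simp: finite_hypermaps hypermaps_iff disjoint_iff)
  also have "(\<Union>bs\<in>?B. hypermaps a g bs) = ?f ` ?S"
  proof (intro equalityI subsetI)
    fix t assume "t \<in> (\<Union>bs\<in>?B. hypermaps a g bs)"
    then obtain bs where bs: "bs \<in> ?B" "t \<in> hypermaps a g bs" by blast
    then obtain v where "t = ?f v"
      "v \<in> {(u, cs) \<in> Sigma (hypermap_pairs a g (length bs) (sum_list bs)) (labellings (sum_list bs)). map card cs = bs}"
      unfolding hypermaps_eq_image by blast
    then show "t \<in> ?f ` ?S" using bs(1) by (intro image_eqI[of _ _ v]) auto
  next
    fix t assume "t \<in> ?f ` ?S"
    then obtain u cs where u: "(u, cs) \<in> ?S" "t = ?f (u, cs)" by blast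
    have "t \<in> hypermaps a g (map card cs)"
      unfolding hypermaps_eq_image u(2) using u(1) shape[OF u(1)] by (intro imageI) simp
    then show "t \<in> (\<Union>bs\<in>?B. hypermaps a g bs)" using shape[OF u(1)] by blast
  qed
  also have "card (?f ` ?S) = card ?S" by (rule card_image) (auto simp: inj_on_def)
  also have "\<dots> = (\<Sum>u\<in>hypermap_pairs a g n d. card (labellings d u))"
    by (rule card_SigmaI[OF finite_hypermap_pairs]) (auto simp: labellings_def)
  also have "\<dots> = (\<Sum>u\<in>hypermap_pairs a g n d. fact n)"
    by (intro sum.cong refl) (auto simp: labellings_def hypermap_pairs_def)
  finally show ?thesis by simp
qed

section \<open>Weighted classes and labelled triples\<close>

lemma conj_by_comp: "bij \<pi> \<Longrightarrow> conj_by \<pi> p \<circ> conj_by \<pi> q = conj_by \<pi> (p \<circ> q)"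
  by (simp add: fun_eq_iff bij_is_inj)

lemma conj_by_inverse:
  assumes "bij \<pi>" "r permutes A"
  shows "Hilbert_Choice.inv (conj_by \<pi> r) = conj_by \<pi> (Hilbert_Choice.inv r)"
proof -
  have "conj_by \<pi> r \<circ> conj_by \<pi> (Hilbert_Choice.inv r) = id"
    unfolding conj_by_comp[OF assms(1)] permutes_inv_o(1)[OF assms(2)]
    using assms(1) by (simp add: fun_eq_iff bij_is_surj surj_f_inv_f)
  then show ?thesis using comp_eq_id_iff_inv[OF conj_by_permutes[OF assms], THEN iffD1] by metis
qed

lemma conjugate_in_hypermaps:
  assumes \<pi>: "\<pi> permutes {1..sum_list bs}" and \<tau>: "\<tau> \<in> hypermaps a g bs"
  shows "conjugate \<pi> \<tau> \<in> hypermaps a g bs"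
proof -
  define A where "A = {1..sum_list bs}"
  obtain p q r cs where e: "\<tau> = (p, q, r, cs)" by (cases \<tau>)
  have b: "bij \<pi>" and A: "\<pi> ` A = A"
    using \<pi> by (simp_all add: A_def permutes_bij permutes_image)
  have h: "(p, q) \<in> hypermap_pairs a g (length bs) (sum_list bs)" "r = Hilbert_Choice.inv (p \<circ> q)"
    "distinct cs" "set cs = blocks A {r}" "map card cs = bs"
    using \<tau> unfolding e hypermaps_iff A_def by blast+
  then have tr: "(p, q) \<in> transitive_pairs A" and reg: "q \<in> regular_perms a A"
    by (auto simp: hypermap_pairs_def A_def)
  then have pq: "p \<circ> q permutes A" by (auto simp: transitive_pairs_def permutes_compose)
  note blocks = blocks_conj_by[OF b, of A, unfolded A] card_blocks_conj_by[OF b, of A, unfolded A]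
  have inv: "Hilbert_Choice.inv (conj_by \<pi> p \<circ> conj_by \<pi> q) = conj_by \<pi> r"
    unfolding conj_by_comp[OF b] conj_by_inverse[OF b pq] h(2) ..
  have "conj_by \<pi> q \<in> regular_perms a A"
    using reg conj_by_permutes[OF b, of q A] regular_conj_by[OF b, of A q a]
    by (simp add: regular_perms_def A)
  moreover have "(conj_by \<pi> p, conj_by \<pi> q) \<in> transitive_pairs A"
    using transitive_pairs_conj_by[OF tr b] by (simp only: A)
  ultimately have "(conj_by \<pi> p, conj_by \<pi> q) \<in> hypermap_pairs a g (length bs) (sum_list bs)"
    using h(1) unfolding hypermap_pairs_def A_def[symmetric] mem_Collect_eq prod.case inv h(2)[symmetric] blocks(2)
    by blast
  moreover have "inj (image \<pi>)" using b by (intro inj_on_image) (simp add: bij_is_inj)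
  then have "distinct (map (image \<pi>) cs)" using h(3) by (simp add: distinct_map inj_on_subset[OF _ subset_UNIV])
  moreover have "set (map (image \<pi>) cs) = blocks A {conj_by \<pi> r}"
    using blocks(1)[of "{r}"] h(4) by simp
  moreover have "card (\<pi> ` c) = card c" for c
    using b by (intro card_image inj_on_subset[OF bij_is_inj]) auto
  then have "map card (map (image \<pi>) cs) = bs" using h(5) by (simp add: comp_def)
  ultimately show ?thesis
    unfolding e conjugate.simps hypermaps_iff A_def[symmetric] inv by blast
qed

text \<open>Relabelling the points by all permutations runs through the class of \<open>\<tau>\<close>, and the permutations
leading to a given triple form a coset of the automorphism group.\<close>

lemma orbit_stabilizer:
  assumes \<tau>: "\<tau> \<in> hypermaps a g bs"
  shows "card (hypermap_equiv a g bs `` {\<tau>}) * card (automorphisms (sum_list bs) \<tau>) = fact (sum_list bs)"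
proof -
  let ?P = "{\<pi>. \<pi> permutes {1..sum_list bs}}"
  let ?C = "hypermap_equiv a g bs `` {\<tau>}"
  have C: "?C = (\<lambda>\<pi>. conjugate \<pi> \<tau>) ` ?P"
    using \<tau> conjugate_in_hypermaps[OF _ \<tau>] unfolding hypermap_equiv_def by blast
  have fin: "finite ?P" by (rule finite_permutations) simp
  have fibre: "card {\<pi>\<in>?P. conjugate \<pi> \<tau> = \<tau>'} = card (automorphisms (sum_list bs) \<tau>)"
    if \<tau>': "\<tau>' \<in> ?C" for \<tau>'
  proof -
    obtain \<rho> where \<rho>: "\<rho> permutes {1..sum_list bs}" "\<tau>' = conjugate \<rho> \<tau>"
      using \<tau>' unfolding C by blast
    let ?i = "Hilbert_Choice.inv \<rho>"
    have i: "?i permutes {1..sum_list bs}" using \<rho>(1) by (rule permutes_inv)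
    have undo: "conjugate ?i (conjugate \<rho> \<tau>) = \<tau>"
      by (simp only: conjugate_conjugate[OF i \<rho>(1)] permutes_inv_o[OF \<rho>(1)] conjugate_id)
    have "bij_betw (\<lambda>\<alpha>. \<rho> \<circ> \<alpha>) (automorphisms (sum_list bs) \<tau>) {\<pi>\<in>?P. conjugate \<pi> \<tau> = \<tau>'}"
    proof (rule bij_betw_byWitness[where f' = "\<lambda>\<pi>. ?i \<circ> \<pi>"])
      show "\<forall>\<alpha>\<in>automorphisms (sum_list bs) \<tau>. ?i \<circ> (\<rho> \<circ> \<alpha>) = \<alpha>"
        "\<forall>\<pi>\<in>{\<pi>\<in>?P. conjugate \<pi> \<tau> = \<tau>'}. \<rho> \<circ> (?i \<circ> \<pi>) = \<pi>"
        using permutes_inverses[OF \<rho>(1)] by (simp_all add: fun_eq_iff)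
      show "(\<lambda>\<alpha>. \<rho> \<circ> \<alpha>) ` automorphisms (sum_list bs) \<tau> \<subseteq> {\<pi>\<in>?P. conjugate \<pi> \<tau> = \<tau>'}"
      proof clarify
        fix \<alpha> assume "\<alpha> \<in> automorphisms (sum_list bs) \<tau>"
        then have \<alpha>: "\<alpha> permutes {1..sum_list bs}" "conjugate \<alpha> \<tau> = \<tau>"
          by (simp_all add: automorphisms_def)
        have "conjugate (\<rho> \<circ> \<alpha>) \<tau> = \<tau>'"
          by (simp only: conjugate_conjugate[OF \<rho>(1) \<alpha>(1), symmetric] \<alpha>(2) \<rho>(2))
        then show "\<rho> \<circ> \<alpha> \<in> ?P \<and> conjugate (\<rho> \<circ> \<alpha>) \<tau> = \<tau>'"
          using permutes_compose[OF \<alpha>(1) \<rho>(1)] by simp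
      qed
      show "(\<lambda>\<pi>. ?i \<circ> \<pi>) ` {\<pi>\<in>?P. conjugate \<pi> \<tau> = \<tau>'} \<subseteq> automorphisms (sum_list bs) \<tau>"
      proof clarify
        fix \<pi> assume \<pi>: "\<pi> permutes {1..sum_list bs}" and eq: "\<tau>' = conjugate \<pi> \<tau>"
        have "conjugate (?i \<circ> \<pi>) \<tau> = \<tau>"
          by (simp only: conjugate_conjugate[OF i \<pi>, symmetric] eq[symmetric] \<rho>(2) undo)
        then show "?i \<circ> \<pi> \<in> automorphisms (sum_list bs) \<tau>"
          using permutes_compose[OF \<pi> i] by (simp add: automorphisms_def)
      qed
    qed
    then show ?thesis by (rule bij_betw_same_card[symmetric])
  qed
  have "fact (sum_list bs) = card ?P"
    using card_permutations[of "{1..sum_list bs}"] by simp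
  also have "\<dots> = (\<Sum>\<pi>\<in>?P. 1)" by simp
  also have "\<dots> = (\<Sum>\<tau>'\<in>?C. \<Sum>\<pi>\<in>{\<pi>\<in>?P. conjugate \<pi> \<tau> = \<tau>'}. 1)"
    by (rule sum.group[symmetric]) (use fin C in auto)
  also have "\<dots> = (\<Sum>\<tau>'\<in>?C. card (automorphisms (sum_list bs) \<tau>))"
    by (rule sum.cong[OF refl]) (use fibre in simp)
  finally show ?thesis by simp
qed

lemma equiv_hypermap_equiv: "equiv (hypermaps a g bs) (hypermap_equiv a g bs)"
proof (rule equivI)
  show "hypermap_equiv a g bs \<subseteq> hypermaps a g bs \<times> hypermaps a g bs"
    by (auto simp: hypermap_equiv_def)
  show "refl_on (hypermaps a g bs) (hypermap_equiv a g bs)"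
    by (rule refl_onI) (auto simp: hypermap_equiv_def conjugate_id intro!: exI[of _ id])
  show "sym (hypermap_equiv a g bs)"
  proof (rule symI)
    fix \<tau> \<tau>' assume "(\<tau>, \<tau>') \<in> hypermap_equiv a g bs"
    then obtain \<pi> where \<pi>: "\<tau> \<in> hypermaps a g bs" "\<tau>' \<in> hypermaps a g bs"
      "\<pi> permutes {1..sum_list bs}" "\<tau>' = conjugate \<pi> \<tau>" by (auto simp: hypermap_equiv_def)
    have "\<tau> = conjugate (Hilbert_Choice.inv \<pi>) \<tau>'"
      by (simp only: \<pi>(4) conjugate_conjugate[OF permutes_inv[OF \<pi>(3)] \<pi>(3)]
          permutes_inv_o[OF \<pi>(3)] conjugate_id)
    then show "(\<tau>', \<tau>) \<in> hypermap_equiv a g bs"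
      using \<pi> permutes_inv[OF \<pi>(3)] unfolding hypermap_equiv_def by blast
  qed
  show "trans (hypermap_equiv a g bs)"
  proof (rule transI)
    fix \<tau> \<tau>' \<tau>'' assume "(\<tau>, \<tau>') \<in> hypermap_equiv a g bs" "(\<tau>', \<tau>'') \<in> hypermap_equiv a g bs"
    then obtain \<pi> \<rho> where *: "\<tau> \<in> hypermaps a g bs" "\<tau>'' \<in> hypermaps a g bs"
      "\<pi> permutes {1..sum_list bs}" "\<tau>' = conjugate \<pi> \<tau>"
      "\<rho> permutes {1..sum_list bs}" "\<tau>'' = conjugate \<rho> \<tau>'" by (auto simp: hypermap_equiv_def)
    have "\<tau>'' = conjugate (\<rho> \<circ> \<pi>) \<tau>" by (simp only: *(4,6) conjugate_conjugate[OF *(5,3)])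
    then show "(\<tau>, \<tau>'') \<in> hypermap_equiv a g bs"
      using * permutes_compose[OF *(3,5)] unfolding hypermap_equiv_def by blast
  qed
qed

text \<open>The weight of a class is its cardinality divided by \<open>d!\<close>, so the weighted count of classes is the
plain count of triples divided by \<open>d!\<close>.\<close>

lemma hypermap_count_eq_card:
  "hypermap_count a g bs = of_nat (card (hypermaps a g bs)) / fact (sum_list bs)"
proof -
  let ?X = "hypermaps a g bs" and ?R = "hypermap_equiv a g bs"
  have "1 / rat_of_nat (card (automorphisms (sum_list bs) (SOME \<tau>. \<tau> \<in> C)))
      = of_nat (card C) / fact (sum_list bs)" if C: "C \<in> ?X // ?R" for C
  proof -
    define \<tau> where "\<tau> = (SOME \<tau>. \<tau> \<in> C)"
    have ne: "C \<noteq> {}" using C equiv_hypermap_equiv in_quotient_imp_non_empty by blast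
    then have \<tau>C: "\<tau> \<in> C" unfolding \<tau>_def by (simp add: some_in_eq)
    then have \<tau>: "\<tau> \<in> ?X" using C equiv_hypermap_equiv in_quotient_imp_subset by blast
    obtain \<tau>0 where "C = ?R `` {\<tau>0}" using C by (rule quotientE)
    then have "C = ?R `` {\<tau>}"
      using \<tau>C equiv_class_eq[OF equiv_hypermap_equiv, of \<tau>0 \<tau>] by simp
    then have *: "card C * card (automorphisms (sum_list bs) \<tau>) = fact (sum_list bs)"
      using orbit_stabilizer[OF \<tau>] by simp
    then have "rat_of_nat (card C) * of_nat (card (automorphisms (sum_list bs) \<tau>)) = fact (sum_list bs)"
      by (simp flip: of_nat_mult)
    moreover have "card (automorphisms (sum_list bs) \<tau>) \<noteq> 0" by (rule notI) (use *[symmetric] in simp)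
    ultimately show ?thesis unfolding \<tau>_def[symmetric] by (simp add: field_simps)
  qed
  then have "hypermap_count a g bs = (\<Sum>C\<in>?X // ?R. of_nat (card C) / fact (sum_list bs))"
    unfolding hypermap_count_def by (rule sum.cong[OF refl])
  also have "\<dots> = of_nat (\<Sum>C\<in>?X // ?R. card C) / fact (sum_list bs)"
    by (simp add: sum_divide_distrib)
  also have "(\<Sum>C\<in>?X // ?R. card C) = card (\<Union>(?X // ?R))"
  proof (rule card_Union_disjoint[symmetric])
    show "pairwise disjnt (?X // ?R)"
      using quotient_disj[OF equiv_hypermap_equiv] unfolding pairwise_def disjnt_def by blast
    show "finite C" if "C \<in> ?X // ?R" for C
      using in_quotient_imp_subset[OF equiv_hypermap_equiv that] finite_hypermaps
      by (rule finite_subset)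
  qed
  also have "\<Union>(?X // ?R) = ?X" by (rule Union_quotient[OF equiv_hypermap_equiv])
  finally show ?thesis .
qed

lemma sum_hypermap_count:
  "(\<Sum>bs\<in>{bs. length bs = n \<and> (\<forall>b\<in>set bs. b \<ge> 1) \<and> sum_list bs = d}. hypermap_count a g bs)
     = fact n * of_nat (card (hypermap_pairs a g n d)) / fact d"
proof -
  have "(\<Sum>bs\<in>{bs. length bs = n \<and> (\<forall>b\<in>set bs. b \<ge> 1) \<and> sum_list bs = d}. hypermap_count a g bs)
    = (\<Sum>bs\<in>{bs. length bs = n \<and> (\<forall>b\<in>set bs. b \<ge> 1) \<and> sum_list bs = d}.
        of_nat (card (hypermaps a g bs)) / fact d)"
    by (rule sum.cong[OF refl]) (simp add: hypermap_count_eq_card)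
  also have "\<dots> = of_nat (\<Sum>bs\<in>{bs. length bs = n \<and> (\<forall>b\<in>set bs. b \<ge> 1) \<and> sum_list bs = d}.
        card (hypermaps a g bs)) / fact d"
    by (simp add: sum_divide_distrib)
  finally show ?thesis unfolding sum_card_hypermaps by simp
qed

section \<open>The logarithm of the partition function\<close>

lemma hbar_monom_mult: "hbar_monom b k * hbar_monom c l = hbar_monom (b * c) (k + l)"
  by (simp add: hbar_monom_def mult_single)

lemma hbar_monom_1: "hbar_monom 1 0 = 1"
  by (simp add: hbar_monom_def)

lemma of_nat_eq_hbar_monom: "of_nat n = hbar_monom (of_nat n) 0"
  by (simp add: hbar_monom_def)

lemma linked_inv:
  assumes "r permutes A"
  shows "linked {Hilbert_Choice.inv r} = linked {r}"
proof (intro equalityI subrelI)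
  fix x y
  show "(x, y) \<in> linked {r}" if "(x, y) \<in> linked {Hilbert_Choice.inv r}"
  proof (rule linked_le[OF that])
    fix p z assume "p \<in> {Hilbert_Choice.inv r}"
    then show "(z, p z) \<in> linked {r}"
      using linked_sym[OF linked_step[of r "{r}" "p z"]] permutes_inverses(1)[OF assms] by simp
  qed
  show "(x, y) \<in> linked {Hilbert_Choice.inv r}" if "(x, y) \<in> linked {r}"
  proof (rule linked_le[OF that])
    fix p z assume "p \<in> {r}"
    then show "(z, p z) \<in> linked {Hilbert_Choice.inv r}"
      using linked_sym[OF linked_step[of "Hilbert_Choice.inv r" "{Hilbert_Choice.inv r}" "p z"]]
        permutes_inverses(2)[OF assms] by simp
  qed
qed

text \<open>All cycles of \<open>q\<close> have length \<open>a\<close>, so \<open>d / a\<close> is their number, and the condition on the number of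
cycles of \<open>p\<close> becomes an equation between natural numbers: the Euler characteristic of the
sphere with \<open>g\<close> handles.\<close>

lemma hypermap_pairs_iff:
  assumes "0 < a" and tr: "(p, q) \<in> transitive_pairs {1..d}" and reg: "q \<in> regular_perms a {1..d}"
  shows "(p, q) \<in> hypermap_pairs a g n d \<longleftrightarrow> card (blocks {1..d} {p \<circ> q}) = n \<and>
    card (blocks {1..d} {p}) + card (blocks {1..d} {q}) + n + 2 * g = d + 2"
proof -
  let ?c = "\<lambda>r. card (blocks {1..d} {r})"
  have pq: "p \<circ> q permutes {1..d}" using tr by (auto simp: transitive_pairs_def permutes_compose)
  have inv: "?c (Hilbert_Choice.inv (p \<circ> q)) = ?c (p \<circ> q)"
    using blocks_cong[OF linked_inv[OF pq]] by simp
  have d: "d = a * ?c q"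
    using card_regular[of "{1..d}" q a] reg by (simp add: regular_perms_def)
  have dq: "rat_of_nat d / of_nat a = of_nat (?c q)"
    using assms(1) by (subst d) simp
  have ad: "rat_of_nat d = of_nat a * of_nat (?c q)" by (subst d) simp
  have "(of_nat (?c p) :: rat) = 2 - 2 * of_nat g - of_nat n + (of_nat a - 1) * (of_nat d / of_nat a)
    \<longleftrightarrow> rat_of_nat (?c p + ?c q + n + 2 * g) = of_nat (d + 2)"
    unfolding dq of_nat_add ad using assms(1) by (auto simp: algebra_simps)
  then have "(of_nat (?c p) :: rat) = 2 - 2 * of_nat g - of_nat n + (of_nat a - 1) * (of_nat d / of_nat a)
    \<longleftrightarrow> ?c p + ?c q + n + 2 * g = d + 2"
    unfolding of_nat_eq_iff .
  then show ?thesis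
    unfolding hypermap_pairs_def mem_Collect_eq prod.case inv using tr reg by blast
qed

text \<open>By Riemann-Hurwitz the exponent \<open>2 g - 2 + n\<close> of \<open>\<hbar>\<close> equals \<open>(a - 1) c(q) - c(p)\<close>, where \<open>c\<close>
counts cycles. In this form it is defined for every pair and additive over components.\<close>

definition hypermap_weight :: "nat \<Rightarrow> 'a set \<Rightarrow> ('a \<Rightarrow> 'a) \<Rightarrow> ('a \<Rightarrow> 'a) \<Rightarrow> hbar_laurent" where
  "hypermap_weight a A p q = (if \<forall>c\<in>blocks A {q}. card c = a
     then hbar_monom 1 ((int a - 1) * int (card (blocks A {q})) - int (card (blocks A {p}))) else 0)"

text \<open>The factor \<open>1 / n!\<close> of the free energy cancels the number of labellings.\<close>

lemma log_partition_term_nth: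
  assumes "0 < a"
  shows "log_partition_term a g n $ d = hbar_monom (1 / fact d) 0 *
    (\<Sum>(p, q)\<in>hypermap_pairs a g n d. hypermap_weight a {1..d} p q)"
proof -
  have w: "hypermap_weight a {1..d} p q = hbar_monom 1 (2 * int g - 2 + int n)"
    if "(p, q) \<in> hypermap_pairs a g n d" for p q
  proof -
    have tr: "(p, q) \<in> transitive_pairs {1..d}" and reg: "q \<in> regular_perms a {1..d}"
      using that by (auto simp: hypermap_pairs_def)
    let ?c = "\<lambda>r. card (blocks {1..d} {r})"
    have "?c p + ?c q + n + 2 * g = d + 2"
      using that hypermap_pairs_iff[OF assms tr reg] by blast
    moreover have "d = a * ?c q"
      using card_regular[of "{1..d}" q a] reg by (simp add: regular_perms_def)
    ultimately have "?c p + ?c q + n + 2 * g = a * ?c q + 2" by simp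
    then have "int (?c p) + int (?c q) + int n + 2 * int g = int a * int (?c q) + 2"
      by (metis of_nat_add of_nat_mult of_nat_numeral)
    then have "(int a - 1) * int (?c q) - int (?c p) = 2 * int g - 2 + int n"
      by (simp add: algebra_simps)
    then show ?thesis using reg by (simp add: hypermap_weight_def regular_perms_def)
  qed
  have "log_partition_term a g n $ d
      = hbar_monom (of_nat (card (hypermap_pairs a g n d)) / fact d) (2 * int g - 2 + int n)"
    by (simp add: log_partition_term_def free_energy_diag_def sum_hypermap_count[simplified] hbar_monom_mult)
  also have "\<dots> = hbar_monom (1 / fact d) 0 * (of_nat (card (hypermap_pairs a g n d)) * hbar_monom 1 (2 * int g - 2 + int n))"
    by (simp add: of_nat_eq_hbar_monom hbar_monom_mult)
  also have "of_nat (card (hypermap_pairs a g n d)) * hbar_monom 1 (2 * int g - 2 + int n)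
      = (\<Sum>u\<in>hypermap_pairs a g n d. hbar_monom 1 (2 * int g - 2 + int n))"
    by simp
  also have "\<dots> = (\<Sum>(p, q)\<in>hypermap_pairs a g n d. hypermap_weight a {1..d} p q)"
    by (rule sum.cong[OF refl]) (use w in auto)
  finally show ?thesis .
qed

text \<open>Every transitive pair has exactly one genus \<open>g\<close> and one number \<open>n\<close> of points over infinity, so the
double sum over \<open>g\<close> and \<open>n\<close> exhausts the transitive pairs. That the genus is a natural number is
the content of \<open>euler_characteristic\<close>.\<close>

lemma sum_hypermap_pairs:
  assumes a: "0 < a" and d: "0 < d"
  shows "(\<Sum>g\<le>d. \<Sum>n\<le>d. \<Sum>(p, q)\<in>hypermap_pairs a g (Suc n) d. hypermap_weight a {1..d} p q)
    = transitive_pair_sum (hypermap_weight a) {1..d}"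
proof -
  let ?A = "{1..d}"
  let ?c = "\<lambda>r. card (blocks ?A {r})"
  let ?R = "{(p, q) \<in> transitive_pairs ?A. q \<in> regular_perms a ?A}"
  let ?w = "\<lambda>(p, q). hypermap_weight a ?A p q"
  \<comment> \<open>genus and number of points over infinity, the latter shifted to start at \<open>0\<close> like the series\<close>
  let ?key = "\<lambda>(p, q). ((d + 2 - (?c p + ?c q + ?c (p \<circ> q))) div 2, ?c (p \<circ> q) - 1)"
  have fin: "finite ?R"
    by (rule finite_subset[OF _ finite_transitive_pairs[of ?A]]) auto
  have pos: "?c r > 0" for r using d by (intro card_blocks_pos) auto
  have euler: "\<exists>g. ?c p + ?c q + ?c (p \<circ> q) + 2 * g = d + 2" if "(p, q) \<in> transitive_pairs ?A" for p q
  proof -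
    have "card (blocks ?A {q, p}) = 1"
      using that d transitive_iff_card_blocks[of ?A "{p, q}"]
      by (auto simp: transitive_pairs_def insert_commute)
    then show ?thesis
      using that euler_characteristic[of ?A q p] by (auto simp: transitive_pairs_def add_ac)
  qed
  have fibre: "{u \<in> ?R. ?key u = (g, n)} = hypermap_pairs a g (Suc n) d" for g n
  proof (intro equalityI subsetI)
    fix u assume "u \<in> {u \<in> ?R. ?key u = (g, n)}"
    then obtain p q where u: "u = (p, q)" and tr: "(p, q) \<in> transitive_pairs ?A"
      and reg: "q \<in> regular_perms a ?A" and key: "?key (p, q) = (g, n)" by auto
    obtain g' where g': "?c p + ?c q + ?c (p \<circ> q) + 2 * g' = d + 2" using euler[OF tr] by blast
    then have "g = g'" using key by auto
    moreover have "?c (p \<circ> q) = Suc n" using key pos[of "p \<circ> q"] by auto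
    ultimately show "u \<in> hypermap_pairs a g (Suc n) d"
      unfolding u hypermap_pairs_iff[OF a tr reg] using g' by simp
  next
    fix u assume u: "u \<in> hypermap_pairs a g (Suc n) d"
    then obtain p q where e: "u = (p, q)" and tr: "(p, q) \<in> transitive_pairs ?A"
      and reg: "q \<in> regular_perms a ?A" by (auto simp: hypermap_pairs_def)
    have "?c (p \<circ> q) = Suc n" "?c p + ?c q + Suc n + 2 * g = d + 2"
      using u unfolding e hypermap_pairs_iff[OF a tr reg] by blast+
    then have "?key (p, q) = (g, n)" unfolding prod.case by simp
    then show "u \<in> {u \<in> ?R. ?key u = (g, n)}" using e tr reg by simp
  qed
  have range: "?key ` ?R \<subseteq> {..d} \<times> {..d}"
  proof (rule image_subsetI)
    fix u assume "u \<in> ?R"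
    then obtain p q where u: "u = (p, q)" and tr: "(p, q) \<in> transitive_pairs ?A" by auto
    obtain g' where g': "?c p + ?c q + ?c (p \<circ> q) + 2 * g' = d + 2" using euler[OF tr] by blast
    then show "?key u \<in> {..d} \<times> {..d}"
      unfolding u prod.case using pos[of p] pos[of q] pos[of "p \<circ> q"] by auto
  qed
  have "(\<Sum>g\<le>d. \<Sum>n\<le>d. \<Sum>u\<in>hypermap_pairs a g (Suc n) d. ?w u)
      = (\<Sum>k\<in>{..d} \<times> {..d}. \<Sum>u\<in>{u \<in> ?R. ?key u = k}. ?w u)"
    by (simp only: sum.cartesian_product flip: fibre) (simp add: case_prod_unfold prod_eq_iff)
  also have "\<dots> = (\<Sum>u\<in>?R. ?w u)"
    by (rule sum.group[OF fin _ range]) simp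
  also have "\<dots> = (\<Sum>u\<in>transitive_pairs ?A. ?w u)"
  proof (rule sum.mono_neutral_left)
    show "finite (transitive_pairs ?A)" by (rule finite_transitive_pairs) simp
    show "\<forall>u\<in>transitive_pairs ?A - ?R. ?w u = 0"
      by (auto simp: hypermap_weight_def regular_perms_def transitive_pairs_def split: if_splits)
  qed auto
  finally show ?thesis unfolding transitive_pair_sum_def .
qed

lemma log_partition_nth_transitive:
  assumes "0 < a" "0 < d"
  shows "log_partition a $ d = hbar_monom (1 / fact d) 0 * transitive_pair_sum (hypermap_weight a) {1..d}"
  unfolding log_partition_nth log_partition_term_nth[OF assms(1)] sum_hypermap_pairs[OF assms, symmetric]
  by (simp add: sum_distrib_left)

section \<open>The coefficients of the partition function\<close>

lemma multiplicative_hypermap_weight: "multiplicative_weight (hypermap_weight a)"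
proof
  fix B D :: "'a set" and p q p' q' :: "'a \<Rightarrow> 'a"
  assume *: "finite B" "finite D" "B \<inter> D = {}" "p permutes B" "q permutes B" "p' permutes D" "q' permutes D"
  have card: "card (blocks (B \<union> D) {r \<circ> r'}) = card (blocks B {r}) + card (blocks D {r'})"
    if "r permutes B" "r' permutes D" for r r' :: "'a \<Rightarrow> 'a"
    unfolding blocks_disjoint_comp(1)[OF that *(3)]
    using blocks_disjoint_comp(2)[OF that *(3)] * by (simp add: card_Un_disjoint)
  show "hypermap_weight a (B \<union> D) (p \<circ> p') (q \<circ> q') = hypermap_weight a B p q * hypermap_weight a D p' q'"
    unfolding hypermap_weight_def regular_disjoint_comp[OF *(5,7,3)] card[OF *(4,6)] card[OF *(5,7)]
    by (simp add: hbar_monom_mult algebra_simps)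
next
  fix \<pi> :: "'a \<Rightarrow> 'a" and B :: "'a set" and p q :: "'a \<Rightarrow> 'a"
  assume *: "bij \<pi>"
  show "hypermap_weight a (\<pi> ` B) (conj_by \<pi> p) (conj_by \<pi> q) = hypermap_weight a B p q"
    unfolding hypermap_weight_def regular_conj_by[OF *] card_blocks_conj_by[OF *] ..
qed

lemma of_int_hbar: "of_int k = hbar_monom (of_int k) 0"
  by (simp add: hbar_monom_def)

lemma hbar_monom_power: "hbar_monom 1 k ^ n = hbar_monom 1 (k * int n)"
  by (induction n) (simp_all add: hbar_monom_1 hbar_monom_mult algebra_simps)

text \<open>Without the transitivity condition the two permutations of a pair are independent of each other,
and the sum factors.\<close>

lemma pair_sum_hypermap_weight:
  assumes "finite A"
  shows "pair_sum (hypermap_weight a) A =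
    (\<Sum>q\<in>regular_perms a A. hbar_monom 1 ((int a - 1) * int (card (blocks A {q}))))
      * pochhammer (hbar_monom 1 (-1)) (card A)"
proof -
  have w: "hypermap_weight a A p q = (if q \<in> regular_perms a A
      then hbar_monom 1 (-1) ^ card (blocks A {p}) * hbar_monom 1 ((int a - 1) * int (card (blocks A {q}))) else 0)"
    if "q permutes A" for p q
    using that by (simp add: hypermap_weight_def regular_perms_def hbar_monom_power hbar_monom_mult)
  have sub: "regular_perms a A \<subseteq> {q. q permutes A}" by (auto simp: regular_perms_def)
  have "pair_sum (hypermap_weight a) A = (\<Sum>p | p permutes A. \<Sum>q | q permutes A. hypermap_weight a A p q)"
    unfolding pair_sum_def by (simp add: sum.cartesian_product)
  also have "\<dots> = (\<Sum>p | p permutes A. \<Sum>q\<in>regular_perms a A.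
      hbar_monom 1 (-1) ^ card (blocks A {p}) * hbar_monom 1 ((int a - 1) * int (card (blocks A {q}))))"
    by (intro sum.cong refl sum.mono_neutral_cong_right)
      (use sub assms finite_permutations w in auto)
  also have "\<dots> = (\<Sum>q\<in>regular_perms a A. hbar_monom 1 ((int a - 1) * int (card (blocks A {q}))))
      * (\<Sum>p | p permutes A. hbar_monom 1 (-1) ^ card (blocks A {p}))"
    by (simp add: sum_product[symmetric] mult.commute)
  finally show ?thesis unfolding sum_permutations_power_cycles[OF assms] .
qed

definition partition_coeff :: "nat \<Rightarrow> nat \<Rightarrow> hbar_laurent" where
  "partition_coeff a d = hbar_monom (1 / fact d) 0 * pair_sum (hypermap_weight a) {1..d}"

lemma partition_coeff_0: "partition_coeff a 0 = 1"
  by (simp add: partition_coeff_def pair_sum_def hypermap_weight_def blocks_def hbar_monom_1)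

text \<open>The exponential formula, divided by the factorials.\<close>

lemma partition_coeff_Suc:
  assumes "0 < a"
  shows "of_nat (Suc d) * partition_coeff a (Suc d)
    = (\<Sum>k\<le>d. of_nat (Suc k) * log_partition a $ Suc k * partition_coeff a (d - k))"
proof -
  interpret multiplicative_weight "hypermap_weight a :: nat set \<Rightarrow> _"
    by (rule multiplicative_hypermap_weight)
  let ?T = "\<lambda>n. pair_sum (hypermap_weight a) {1..n}"
  let ?C = "\<lambda>n. transitive_pair_sum (hypermap_weight a) {1..n}"
  have "of_nat (Suc d) * partition_coeff a (Suc d) = hbar_monom (1 / fact d) 0 * ?T (Suc d)"
    by (simp add: partition_coeff_def of_nat_eq_hbar_monom hbar_monom_mult mult.assoc[symmetric] del: of_nat_Suc)
  also have "?T (Suc d) = (\<Sum>k\<le>d. of_nat (d choose k) * (?C (Suc k) * ?T (d - k)))"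
    using pair_sum_Suc[of "\<lambda>n. {1..n}" d] by simp
  also have "hbar_monom (1 / fact d) 0 * \<dots>
      = (\<Sum>k\<le>d. of_nat (Suc k) * log_partition a $ Suc k * partition_coeff a (d - k))"
    unfolding sum_distrib_left
  proof (rule sum.cong[OF refl])
    fix k assume "k \<in> {..d}"
    then have "hbar_monom (1 / fact d) 0 * of_nat (d choose k)
        = hbar_monom (of_nat (Suc k) * (1 / fact (Suc k)) * (1 / fact (d - k))) 0"
      by (simp add: of_nat_eq_hbar_monom hbar_monom_mult binomial_fact del: of_nat_Suc)
    also have "\<dots> = of_nat (Suc k) * hbar_monom (1 / fact (Suc k)) 0 * hbar_monom (1 / fact (d - k)) 0"
      by (simp add: of_nat_eq_hbar_monom hbar_monom_mult del: of_nat_Suc fact_Suc)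
    finally show "hbar_monom (1 / fact d) 0 * (of_nat (d choose k) * (?C (Suc k) * ?T (d - k)))
        = of_nat (Suc k) * log_partition a $ Suc k * partition_coeff a (d - k)"
      unfolding log_partition_nth_transitive[OF assms zero_less_Suc] partition_coeff_def
      by (simp only: mult.assoc[symmetric]) (simp only: mult_ac)
  qed
  finally show ?thesis .
qed

lemma deriv_exp_series: "fps_deriv exp_series = exp_series"
  by (rule fps_ext) (simp add: exp_series_def of_nat_eq_hbar_monom hbar_monom_mult del: of_nat_Suc)

text \<open>\<open>Zbar\<close> and the generating function of all pairs have the constant term \<open>1\<close> and satisfy the same
linear differential equation \<open>Z' = L' Z\<close>, which determines the coefficients one after the other.\<close>

lemma Zbar_nth:
  assumes "0 < a"
  shows "Zbar a $ d = partition_coeff a d"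
proof (induction d rule: less_induct)
  case (less d)
  show ?case
  proof (cases d)
    case 0
    then show ?thesis by (simp add: Zbar_def exp_series_def partition_coeff_0 hbar_monom_1)
  next
    case (Suc e)
    have "fps_deriv (Zbar a) = Zbar a * fps_deriv (log_partition a)"
      unfolding Zbar_def fps_compose_deriv[OF log_partition_nth_0] deriv_exp_series ..
    then have "fps_deriv (Zbar a) $ e = (fps_deriv (log_partition a) * Zbar a) $ e"
      by (simp only: mult.commute)
    then have "of_nat (Suc e) * Zbar a $ Suc e
        = (\<Sum>k\<le>e. of_nat (Suc k) * log_partition a $ Suc k * Zbar a $ (e - k))"
      by (simp add: fps_mult_nth atLeast0AtMost del: of_nat_Suc)
    also have "\<dots> = (\<Sum>k\<le>e. of_nat (Suc k) * log_partition a $ Suc k * partition_coeff a (e - k))"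
      using less Suc by (intro sum.cong refl) simp
    also have "\<dots> = of_nat (Suc e) * partition_coeff a (Suc e)"
      by (rule partition_coeff_Suc[OF assms, symmetric])
    finally show ?thesis unfolding Suc by (simp del: of_nat_Suc)
  qed
qed

section \<open>The quantum curve\<close>

text \<open>For \<open>a\<close> not dividing \<open>d\<close> there is no permutation with all cycles of length \<open>a\<close>; the truncation in
\<open>d div a\<close> is then harmless.\<close>

lemma partition_coeff_closed:
  assumes "0 < a"
  shows "partition_coeff a d = hbar_monom (of_nat (card (regular_perms a {1..d})) / fact d)
      ((int a - 1) * int (d div a)) * pochhammer (hbar_monom 1 (-1)) d"
proof -
  have "card (blocks {1..d} {q}) = d div a" if "q \<in> regular_perms a {1..d}" for q
  proof -
    have "d = a * card (blocks {1..d} {q})"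
      using that card_regular[of "{1..d}" q a] by (simp add: regular_perms_def)
    then have "d div a = a * card (blocks {1..d} {q}) div a" by (rule arg_cong)
    then show ?thesis using assms by simp
  qed
  then have "(\<Sum>q\<in>regular_perms a {1..d}. hbar_monom 1 ((int a - 1) * int (card (blocks {1..d} {q}))))
      = of_nat (card (regular_perms a {1..d})) * hbar_monom 1 ((int a - 1) * int (d div a))"
    by simp
  then show ?thesis
    unfolding partition_coeff_def pair_sum_hypermap_weight[OF finite_atLeastAtMost]
    by (simp add: of_nat_eq_hbar_monom hbar_monom_mult mult.assoc[symmetric])
qed

text \<open>Both factors of the coefficient are hypergeometric: the number of permutations with all cycles of
length \<open>a\<close>, divided by \<open>d!\<close>, is multiplied by \<open>1 / (d + a)\<close> when \<open>d\<close> grows by \<open>a\<close>, and the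
rising factorial gets \<open>a\<close> more factors. This is the quantum curve equation read off at the power
\<open>- (d + a)\<close> of \<open>x\<close>.\<close>

lemma partition_coeff_rec:
  assumes "0 < a"
  shows "hbar_monom (of_nat (d + a)) 1 * partition_coeff a (d + a)
      = hbar_monom 1 (int a) * pochhammer (hbar_monom 1 (-1) + of_nat d) a * partition_coeff a d"
proof -
  obtain e where e: "d + a = Suc e" using assms by (cases "d + a") auto
  let ?N = "\<lambda>d. rat_of_nat (card (regular_perms a {1..d})) / fact d"
  have "?N (d + a) = 1 / of_nat (d + a) * ?N d"
    using card_regular_perms_rec[of "\<lambda>n. {1..n}" a e] assms e by (simp del: of_nat_Suc) (metis add_diff_cancel_right' le_add2)
  then have N: "of_nat (d + a) * ?N (d + a) = ?N d" using assms by simp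
  have div: "(d + a) div a = Suc (d div a)" using assms by simp
  have "hbar_monom (of_nat (d + a)) 1 * partition_coeff a (d + a)
      = hbar_monom (?N d) (int a + (int a - 1) * int (d div a)) * pochhammer (hbar_monom 1 (-1)) (d + a)"
    unfolding partition_coeff_closed[OF assms, of "d + a"] mult.assoc[symmetric] hbar_monom_mult N div
    by (simp add: algebra_simps)
  also have "pochhammer (hbar_monom 1 (-1)) (d + a)
      = pochhammer (hbar_monom 1 (-1)) d * pochhammer (hbar_monom 1 (-1) + of_nat d) a"
    by (rule pochhammer_product')
  also have "hbar_monom (?N d) (int a + (int a - 1) * int (d div a))
      = hbar_monom 1 (int a) * hbar_monom (?N d) ((int a - 1) * int (d div a))"
    by (simp add: hbar_monom_mult)
  finally show ?thesis unfolding partition_coeff_closed[OF assms, of d] by (simp only: mult_ac)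
qed

lemma partition_coeff_eq_0:
  assumes "0 < a" "0 < d" "d < a"
  shows "partition_coeff a d = 0"
proof -
  obtain e where "d = Suc e" using assms by (cases d) auto
  then have "rat_of_nat (card (regular_perms a {1..d})) / fact d = 0"
    using card_regular_perms_rec[of "\<lambda>n. {1..n}" a e] assms by simp
  then show ?thesis unfolding partition_coeff_closed[OF assms(1)] by (simp add: hbar_monom_def)
qed

text \<open>Conjugation by the formal power of \<open>x\<close> shifts exponents by \<open>1 / \<hbar>\<close>: the operator takes
\<open>x\<close> to the power \<open>- k\<close> to \<open>\<hbar> (k + 1 / \<hbar>)\<close> times \<open>x\<close> to the power \<open>- k - 1\<close>. Its iterates
therefore produce rising factorials.\<close>

lemma y_hat_nth:
  "y_hat f $$ k = hbar_monom 1 1 * (hbar_monom 1 (-1) + of_int (k - 1)) * f $$ (k - 1)"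
proof -
  have "y_hat f $$ k = hbar_monom 1 1 * (fls_X ^ 2 * fls_deriv f) $$ k + (fls_X * f) $$ k"
    unfolding y_hat_eq ddx_def by (simp add: mult.assoc)
  also have "(fls_X ^ 2 * fls_deriv f) $$ k = fls_deriv f $$ (k - 2)"
    by (simp add: fls_X_power_times_conv_shift)
  finally show ?thesis
    by (simp add: fls_X_times_conv_shift algebra_simps hbar_monom_mult hbar_monom_1)
qed

lemma y_hat_pow_nth:
  "(y_hat ^^ n) f $$ k = hbar_monom 1 (int n) * pochhammer (hbar_monom 1 (-1) + of_int (k - int n)) n * f $$ (k - int n)"
proof (induction n arbitrary: k)
  case (Suc n)
  have "(y_hat ^^ Suc n) f $$ k = hbar_monom 1 1 * (hbar_monom 1 (-1) + of_int (k - 1)) * (y_hat ^^ n) f $$ (k - 1)"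
    by (simp add: y_hat_nth)
  also have "\<dots> = hbar_monom 1 (int (Suc n)) * (pochhammer (hbar_monom 1 (-1) + of_int (k - int (Suc n))) n
      * (hbar_monom 1 (-1) + of_int (k - 1))) * f $$ (k - int (Suc n))"
  proof -
    have "hbar_monom 1 (int (Suc n)) = hbar_monom 1 1 * hbar_monom 1 (int n)"
      by (simp add: hbar_monom_mult)
    moreover have "k - 1 - int n = k - int (Suc n)" by simp
    ultimately show ?thesis unfolding Suc.IH by (simp only: mult_ac)
  qed
  also have "hbar_monom 1 (-1) + of_int (k - 1) = hbar_monom 1 (-1) + of_int (k - int (Suc n)) + of_nat n"
    by simp
  finally show ?case unfolding pochhammer_Suc .
qed (simp add: hbar_monom_1)

lemma quantum_curve_nth:
  "((y_hat ^^ a) f - x_hat (y_hat f) + f) $$ k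
    = hbar_monom 1 (int a) * pochhammer (hbar_monom 1 (-1) + of_int (k - int a)) a * f $$ (k - int a)
      - hbar_monom (of_int k) 1 * f $$ k"
proof -
  have "x_hat (y_hat f) $$ k = y_hat f $$ (k + 1)"
    by (simp add: x_hat_def fls_X_inv_times_conv_shift)
  also have "\<dots> = f $$ k + hbar_monom (of_int k) 1 * f $$ k"
    by (simp add: y_hat_nth algebra_simps hbar_monom_mult hbar_monom_1 of_int_hbar)
  finally show ?thesis by (simp add: y_hat_pow_nth)
qed

theorem theorem1:
  fixes a :: nat
  assumes "a > 0"
  shows "(y_hat ^^ a) (fps_to_fls (Zbar a)) - x_hat (y_hat (fps_to_fls (Zbar a)))
           + fps_to_fls (Zbar a) = 0"
proof (rule fls_eqI)
  fix k :: int
  let ?Z = "fps_to_fls (Zbar a)"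
  have Z: "?Z $$ int d = partition_coeff a d" for d using Zbar_nth[OF assms] by simp
  have neg: "?Z $$ j = 0" if "j < 0" for j using that by simp
  have "hbar_monom 1 (int a) * pochhammer (hbar_monom 1 (-1) + of_int (k - int a)) a * ?Z $$ (k - int a)
      = hbar_monom (of_int k) 1 * ?Z $$ k"
  proof (cases "k \<ge> int a")
    case True
    then obtain d where d: "k = int (d + a)" by (metis add.commute nonneg_int_cases le_iff_diff_le_0 diff_ge_0_iff_ge int_ops(5) diff_add_cancel)
    show ?thesis
      using partition_coeff_rec[OF assms, of d] Z[of d] Z[of "d + a"] by (simp add: d)
  next
    case False
    have "hbar_monom (of_int k) 1 * ?Z $$ k = 0"
    proof (cases "k > 0")
      case True
      then obtain d where "k = int d" "0 < d" "d < a" using False by (metis nonneg_int_cases not_le of_nat_0_less_iff of_nat_less_iff order_less_imp_le)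
      then show ?thesis using Z[of d] partition_coeff_eq_0[OF assms, of d] by simp
    next
      case False
      then show ?thesis using neg[of k] by (cases "k = 0") (simp_all add: hbar_monom_def)
    qed
    then show ?thesis using neg[of "k - int a"] False by simp
  qed
  then show "((y_hat ^^ a) ?Z - x_hat (y_hat ?Z) + ?Z) $$ k = 0 $$ k"
    unfolding quantum_curve_nth by simp
qed

end
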